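(* For every Markov chain, the relations on its states satisfy $\precsim\;=\;\precsim_{\mathit{safe}}\;=\;\precsim^2_{\mathit{live}}\;\subsetneq\;\precsim^1_{\mathit{live}}$ (the last inclusion being strict in general, i.e., $\precsim^2_{\mathit{live}}\subseteq\precsim^1_{\mathit{live}}$ always, and they differ for some Markov chain).
   Context: A Markov chain (MC) is $\mathsf{D}=(S,\mathit{AP},\to,L,s_0)$ with $S$ countable, $\mathit{AP}$ a finite non-empty set of atomic propositions, $\to:S\to\mathit{Dist}(S)$ a total transition function, $L:S\to\mathcal{P}(\mathit{AP})$, initial state $s_0$. PCTL: state formulas $\Phi::=a\mid\Phi_1\land\Phi_2\mid\neg\Phi\mid\mathbb{P}_{\bowtie q}(\varphi)$, path formulas $\varphi::=\mathsf{X}\Phi\mid\Phi_1\mathsf{U}\Phi_2\mid\Phi_1\mathsf{W}\Phi_2$, $\bowtie\in\{<,>,\le,\ge\}$, $q\in[0,1]$, with the standard semantics $s\models\Phi$ on states of MCs ($\pi\models\Phi_1\mathsf{W}\Phi_2$ iff $\pi\models\Phi_1\mathsf{U}\Phi_2$ or all states of $\pi$ satisfy $\Phi_1$); formulas in positive normal form; $\top=a\lor\neg a$, $\bot=\neg\top$, $\Diamond\Phi=\top\mathsf{U}\Phi$. $\Phi\equiv\Psi$ means $\Phi,\Psi$ are satisfied by the same MCs. Literal formulas: $\Phi^a::=a\mid\neg\Phi^a\mid\Phi^a_1\land\Phi^a_2$. $\text{PCTL}_{\mathit{safe}}$: smallest set $\mathcal{F}$ with (1) $\Phi^a\in\mathcal{F}$;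 (2) $\Phi\in\mathcal{F}\Rightarrow\mathbb{P}_{\ge q}(\mathsf{X}\Phi)\in\mathcal{F}$; (3) $\Phi_1,\Phi_2\in\mathcal{F}\Rightarrow\Phi_1\land\Phi_2,\Phi_1\lor\Phi_2,\mathbb{P}_{\ge q}(\Phi_1\mathsf{W}\Phi_2)\in\mathcal{F}$; (4) $\neg\Phi_1,\neg\Phi_2\in\mathcal{F}\Rightarrow\mathbb{P}_{\le q}(\Phi_1\mathsf{U}\Phi_2)\in\mathcal{F}$. $\text{PCTL}_{\mathit{live}}^{<}$: smallest set $\mathcal{F}$ with (1) $\top\in\mathcal{F}$ and $\bot\notin\mathcal{F}$ (no formula equivalent to $\bot$ belongs to $\mathcal{F}$); (2) $\mathbb{P}_{\ge q}(\Diamond\Phi^a)\in\mathcal{F}$; (3) $\Phi_1,\Phi_2\in\mathcal{F}\Rightarrow\Phi_1\land\Phi_2\in\mathcal{F}$; (4) $\Phi_1\in\mathcal{F}$ or $\Phi_2\in\mathcal{F}$ $\Rightarrow$ $\Phi_1\lor\Phi_2,\mathbb{P}_{\ge q}(\Phi_1\mathsf{W}\Phi_2)\in\mathcal{F}$; (5) $\Phi\in\mathcal{F}\Rightarrow\mathbb{P}_{\ge q}(\mathsf{X}\Phi)\in\mathcal{F}$; (6) $\Phi_2\in\mathcal{F}\Rightarrow\mathbb{P}_{\ge q}(\Phi_1\mathsf{U}\Phi_2)\in\mathcal{F}$ for any $\Phi_1$. $\text{PCTL}_{\mathit{live}}^{>}$: same, but clause (6) replaced by: if $\Phi_1\in\mathcal{F}$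 or $\Phi_2\in\mathcal{F}$ then $\mathbb{P}_{\ge q}(\Phi_1\mathsf{U}\Phi_2)\in\mathcal{F}$. A weight function for distributions $\mu_1,\mu_2$ on $S$ w.r.t. $R\subseteq S\times S$ is $\Delta:S\times S\to[0,1]$ with $\Delta(s_1,s_2)>0\Rightarrow s_1Rs_2$, $\mu_1(s_1)=\sum_{s_2}\Delta(s_1,s_2)$ and $\mu_2(s_2)=\sum_{s_1}\Delta(s_1,s_2)$ for all $s_1,s_2$. $R$ is a strong simulation iff $s_1Rs_2$ implies $L(s_1)=L(s_2)$ and a weight function exists for $\mu_1,\mu_2$ w.r.t. $R$, where $s_i\to\mu_i$. $s_1\precsim s_2$ iff $s_1Rs_2$ for some strong simulation $R$. $s_1\precsim_{\mathit{safe}}s_2$ iff for every $\Phi\in\text{PCTL}_{\mathit{safe}}$, $s_2\models\Phi$ implies $s_1\models\Phi$. $s_1\precsim^1_{\mathit{live}}s_2$ (resp. $\precsim^2_{\mathit{live}}$) iff for every $\Phi\in\text{PCTL}_{\mathit{live}}^{<}$ (resp. $\text{PCTL}_{\mathit{live}}^{>}$), $s_1\models\Phi$ implies $s_2\models\Phi$.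
   Formalization: As written, the liveness clauses force formulas equivalent to ⊥, e.g. P≥1(◇(a∧¬a)), into a set that excludes them; here each clause adds only formulas not equivalent to ⊥. Equivalence is tested on Markov chains with states in the natural numbers, which is no loss up to isomorphism. *)

theory Defs
  imports "HOL-Probability.Probability"
begin

section \<open>Markov chains\<close>

record ('s, 'a) mc =
  states :: "'s set"
  aps :: "'a set"
  trans :: "'s \<Rightarrow> 's pmf"
  label :: "'s \<Rightarrow> 'a set"
  init :: 's

definition markov_chain :: "('s, 'a) mc \<Rightarrow> bool" where
  "markov_chain D \<longleftrightarrow>
     countable (states D) \<and> finite (aps D) \<and> aps D \<noteq> {} \<and> init D \<in> states D \<and>
     (\<forall>s\<in>states D. set_pmf (trans D s) \<subseteq> states D \<and> label D s \<subseteq> aps D)"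

text \<open>
  The measure on infinite paths starting in \<open>s\<close> is the Ionescu-Tulcea measure of the kernel which
  chooses \<open>s\<close> at time 0 and follows the transition function afterwards. It lives on all functions
  of type \<^typ>\<open>nat \<Rightarrow> 's\<close>. If \<open>s\<close> is a state of a Markov chain, almost every path stays inside the
  state set.
\<close>

definition path_kernel :: "('s \<Rightarrow> 's pmf) \<Rightarrow> 's \<Rightarrow> nat \<Rightarrow> (nat \<Rightarrow> 's) \<Rightarrow> 's measure" where
  "path_kernel K s n \<omega> = measure_pmf (case n of 0 \<Rightarrow> return_pmf s | Suc m \<Rightarrow> K (\<omega> m))"

definition path_measure :: "('s \<Rightarrow> 's pmf) \<Rightarrow> 's \<Rightarrow> (nat \<Rightarrow> 's) measure" where
  "path_measure K s =
     projective_family.lim UNIV (Ionescu_Tulcea.CI (path_kernel K s) (\<lambda>_. count_space UNIV))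
       (\<lambda>_. count_space UNIV)"

lemma Ionescu_Tulcea_path_kernel: "Ionescu_Tulcea (path_kernel K s) (\<lambda>_. count_space UNIV)"
proof (rule Ionescu_Tulcea.intro)
  fix n
  show "path_kernel K s n \<in>
      measurable (PiM {0..<n} (\<lambda>_. count_space UNIV)) (subprob_algebra (count_space UNIV))"
  proof (cases n)
    case 0
    then show ?thesis
      by (simp add: path_kernel_def[abs_def] space_subprob_algebra measure_pmf.subprob_space_axioms)
  next
    case (Suc m)
    have 1: "(\<lambda>\<omega>. \<omega> m) \<in> measurable (PiM {0..<n} (\<lambda>_. count_space UNIV)) (count_space UNIV)"
      by (rule measurable_component_singleton) (simp add: Suc)
    have 2: "(\<lambda>x. measure_pmf (K x)) \<in> measurable (count_space UNIV) (subprob_algebra (count_space UNIV))"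
      by (simp add: space_subprob_algebra measure_pmf.subprob_space_axioms)
    show ?thesis
      using measurable_compose[OF 1 2] by (simp add: path_kernel_def[abs_def] Suc)
  qed
qed (simp add: path_kernel_def measure_pmf.prob_space_axioms)

lemma sets_path_measure [measurable_cong]:
  "sets (path_measure K s) = sets (PiM UNIV (\<lambda>_. count_space UNIV))"
proof -
  interpret Ionescu_Tulcea "path_kernel K s" "\<lambda>_. count_space UNIV"
    by (rule Ionescu_Tulcea_path_kernel)
  show ?thesis
    unfolding path_measure_def by (rule PF.sets_lim)
qed

lemma space_path_measure [simp]: "space (path_measure K s) = UNIV"
  using sets_eq_imp_space_eq[OF sets_path_measure, of K s] by (simp add: space_PiM)

theorem emeasure_path_cylinder:
  "emeasure (path_measure K s) {\<pi>. \<forall>i\<le>n. \<pi> i = w i} =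
     ennreal (of_bool (w 0 = s) * (\<Prod>i<n. pmf (K (w i)) (w (Suc i))))"
proof -
  let ?M = "\<lambda>_::nat. count_space (UNIV :: 'a set)"
  interpret Ionescu_Tulcea "path_kernel K s" ?M
    by (rule Ionescu_Tulcea_path_kernel)
  let ?u = "\<lambda>_::nat. undefined :: 'a"
  let ?r = "\<lambda>m. restrict w {0..<m}"
  have in_sp: "?r m \<in> space (PiM {0..<m} ?M)" for m
    by (simp add: space_PiM)
  have single: "{?r m} \<in> sets (PiM {0..<m} ?M)" for m
  proof -
    have "PiE {0..<m} (\<lambda>i. {w i}) \<in> sets (PiM {0..<m} ?M)"
      by (rule sets_PiM_I_finite) auto
    also have "PiE {0..<m} (\<lambda>i. {w i}) = {?r m}"
      by (auto simp: PiE_iff extensional_def)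
    finally show ?thesis .
  qed
  have usp: "?u \<in> space (PiM {0..<0} ?M)"
    by (simp add: space_PiM)
  have C_step: "emeasure (C 0 (Suc m) ?u) {?r (Suc m)} =
      emeasure (C 0 m ?u) {?r m} * emeasure (path_kernel K s m (?r m)) {w m}" for m
  proof -
    have spC: "space (C 0 m ?u) = space (PiM {0..<m} ?M)"
      using space_C[OF usp, of m] by simp
    have setsC: "sets (C 0 m ?u) = sets (PiM {0..<m} ?M)"
      using sets_C[OF usp, of m] by simp
    have eP_meas: "eP m \<in> measurable (C 0 m ?u) (subprob_algebra (PiM {0..<Suc m} ?M))"
      using measurable_eP[of m] by (simp add: measurable_cong_sets[OF setsC refl])
    have "emeasure (C 0 (Suc m) ?u) {?r (Suc m)} =
        (\<integral>\<^sup>+x. emeasure (eP m x) {?r (Suc m)} \<partial>C 0 m ?u)"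
      using emeasure_bind[OF _ eP_meas single[of "Suc m"]] spC in_sp[of m] by auto
    also have "\<dots> = (\<integral>\<^sup>+x. emeasure (path_kernel K s m (?r m)) {w m} * indicator {?r m} x \<partial>C 0 m ?u)"
    proof (rule nn_integral_cong)
      fix x assume "x \<in> space (C 0 m ?u)"
      then have x: "x \<in> space (PiM {0..<m} ?M)"
        by (simp add: spC)
      then have ext: "x \<in> extensional {0..<m}"
        by (simp add: space_PiM PiE_iff)
      have eq: "x(m := y) = ?r (Suc m) \<longleftrightarrow> x = ?r m \<and> y = w m" for y
      proof
        assume h: "x(m := y) = ?r (Suc m)"
        have "y = w m" using fun_cong[OF h, of m] by simp
        moreover have "x i = ?r m i" for i
          using fun_cong[OF h, of i] ext by (cases "i < m") (auto simp: extensional_def)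
        ultimately show "x = ?r m \<and> y = w m" by blast
      next
        assume "x = ?r m \<and> y = w m"
        then show "x(m := y) = ?r (Suc m)"
          by (auto simp: restrict_def fun_eq_iff less_Suc_eq)
      qed
      have vimage: "(\<lambda>y. x(m := y)) -` {?r (Suc m)} = (if x = ?r m then {w m} else {})"
        unfolding vimage_def singleton_iff eq by (cases "x = ?r m") simp_all
      show "emeasure (eP m x) {?r (Suc m)} =
          emeasure (path_kernel K s m (?r m)) {w m} * indicator {?r m} x"
        unfolding emeasure_eP[OF x single[of "Suc m"]] vimage by (cases "x = ?r m") simp_all
    qed
    also have "\<dots> = emeasure (path_kernel K s m (?r m)) {w m} * emeasure (C 0 m ?u) {?r m}"
      using single[of m] by (intro nn_integral_cmult_indicator) (simp add: setsC)
    finally show ?thesis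
      by (simp add: mult.commute)
  qed
  have C0: "emeasure (C 0 0 ?u) {?r 0} = 1"
    using single[of 0] by (simp add: restrict_def)
  have C_eq: "emeasure (C 0 (Suc m) ?u) {?r (Suc m)} =
      ennreal (of_bool (w 0 = s) * (\<Prod>i<m. pmf (K (w i)) (w (Suc i))))" for m
  proof (induction m)
    case 0
    have "emeasure (path_kernel K s 0 (?r 0)) {w 0} = of_bool (w 0 = s)"
      by (simp add: path_kernel_def emeasure_pmf_single)
    then show ?case
      unfolding C_step[of 0] C0 by simp
  next
    case (Suc m)
    have "emeasure (path_kernel K s (Suc m) (?r (Suc m))) {w (Suc m)} =
        ennreal (pmf (K (w m)) (w (Suc m)))"
      by (simp add: path_kernel_def emeasure_pmf_single)
    then show ?case
      unfolding C_step[of "Suc m"] Suc.IH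
      by (simp add: ennreal_mult[symmetric] prod_nonneg mult.assoc)
  qed
  have "{\<pi>. \<forall>i\<le>n. \<pi> i = w i} = PF.emb UNIV {0..<Suc n} {?r (Suc n)}"
    by (auto simp: prod_emb_def restrict_def fun_eq_iff less_Suc_eq_le space_PiM) metis
  then have "emeasure (path_measure K s) {\<pi>. \<forall>i\<le>n. \<pi> i = w i} = emeasure (CI {0..<Suc n}) {?r (Suc n)}"
    unfolding path_measure_def using lim[of "{0..<Suc n}", OF _ single[of "Suc n"]] by simp
  also have "\<dots> = emeasure (C 0 (Suc n) ?u) {?r (Suc n)}"
  proof -
    have "PF.emb {0..<Suc n} {0..<Suc n} {?r (Suc n)} = {?r (Suc n)}"
      using in_sp[of "Suc n"] by (intro prod_emb_id) (auto simp: space_PiM)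
    then show ?thesis
      using emeasure_CI[of "{0..<Suc n}" "Suc n", OF _ single[of "Suc n"]] by simp
  qed
  finally show ?thesis
    by (simp only: C_eq)
qed

section \<open>PCTL\<close>

datatype cmp = Lt | Gt | Le | Ge

datatype 'a sform =
    Atom 'a
  | And "'a sform" "'a sform"
  | Neg "'a sform"
  | Prob cmp real "'a pform"
and 'a pform =
    Next "'a sform"
  | Until "'a sform" "'a sform"
  | WUntil "'a sform" "'a sform"

abbreviation Or :: "'a sform \<Rightarrow> 'a sform \<Rightarrow> 'a sform" where
  "Or \<Phi> \<Psi> \<equiv> Neg (And (Neg \<Phi>) (Neg \<Psi>))"

abbreviation Top :: "'a \<Rightarrow> 'a sform" where
  "Top a \<equiv> Or (Atom a) (Neg (Atom a))"

abbreviation Bot :: "'a \<Rightarrow> 'a sform" where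
  "Bot a \<equiv> Neg (Top a)"

primrec pctl :: "'a set \<Rightarrow> 'a sform \<Rightarrow> bool"
  and pctl_path :: "'a set \<Rightarrow> 'a pform \<Rightarrow> bool" where
  "pctl A (Atom a) \<longleftrightarrow> a \<in> A"
| "pctl A (And \<Phi> \<Psi>) \<longleftrightarrow> pctl A \<Phi> \<and> pctl A \<Psi>"
| "pctl A (Neg \<Phi>) \<longleftrightarrow> pctl A \<Phi>"
| "pctl A (Prob c q \<phi>) \<longleftrightarrow> q \<in> {0..1} \<and> pctl_path A \<phi>"
| "pctl_path A (Next \<Phi>) \<longleftrightarrow> pctl A \<Phi>"
| "pctl_path A (Until \<Phi> \<Psi>) \<longleftrightarrow> pctl A \<Phi> \<and> pctl A \<Psi>"
| "pctl_path A (WUntil \<Phi> \<Psi>) \<longleftrightarrow> pctl A \<Phi> \<and> pctl A \<Psi>"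

fun cmp_sat :: "cmp \<Rightarrow> real \<Rightarrow> real \<Rightarrow> bool" where
  "cmp_sat Lt p q \<longleftrightarrow> p < q"
| "cmp_sat Gt p q \<longleftrightarrow> p > q"
| "cmp_sat Le p q \<longleftrightarrow> p \<le> q"
| "cmp_sat Ge p q \<longleftrightarrow> p \<ge> q"

primrec sat :: "('s, 'a) mc \<Rightarrow> 's \<Rightarrow> 'a sform \<Rightarrow> bool"
  and sat_path :: "('s, 'a) mc \<Rightarrow> (nat \<Rightarrow> 's) \<Rightarrow> 'a pform \<Rightarrow> bool" where
  "sat D s (Atom a) \<longleftrightarrow> a \<in> label D s"
| "sat D s (And \<Phi> \<Psi>) \<longleftrightarrow> sat D s \<Phi> \<and> sat D s \<Psi>"
| "sat D s (Neg \<Phi>) \<longleftrightarrow> \<not> sat D s \<Phi>"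
| "sat D s (Prob c q \<phi>) \<longleftrightarrow>
     cmp_sat c (\<P>(\<pi> in path_measure (trans D) s. sat_path D \<pi> \<phi>)) q"
| "sat_path D \<pi> (Next \<Phi>) \<longleftrightarrow> sat D (\<pi> 1) \<Phi>"
| "sat_path D \<pi> (Until \<Phi> \<Psi>) \<longleftrightarrow> (\<exists>j. sat D (\<pi> j) \<Psi> \<and> (\<forall>i<j. sat D (\<pi> i) \<Phi>))"
| "sat_path D \<pi> (WUntil \<Phi> \<Psi>) \<longleftrightarrow>
     (\<exists>j. sat D (\<pi> j) \<Psi> \<and> (\<forall>i<j. sat D (\<pi> i) \<Phi>)) \<or> (\<forall>i. sat D (\<pi> i) \<Phi>)"

lemma sets_sat_path: "{\<pi>. sat_path D \<pi> \<phi>} \<in> sets (path_measure K s)"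
proof -
  have [measurable]: "Measurable.pred (path_measure K s) (\<lambda>\<pi>. P (\<pi> i))" for P and i :: nat
    unfolding measurable_cong_sets[OF sets_path_measure refl]
    by (rule measurable_compose[OF measurable_component_singleton]) auto
  have "Measurable.pred (path_measure K s) (\<lambda>\<pi>. sat_path D \<pi> \<phi>)"
    by (cases \<phi>) (simp_all, measurable)
  then show ?thesis
    by (simp add: pred_def)
qed

text \<open>
  Every countable Markov chain is isomorphic to one with states in \<^typ>\<open>nat\<close>, so these chains
  suffice to define equivalence of formulas over the propositions \<open>A\<close>.
\<close>

definition mc_equiv :: "'a set \<Rightarrow> 'a sform \<Rightarrow> 'a sform \<Rightarrow> bool" where
  "mc_equiv A \<Phi> \<Psi> \<longleftrightarrow>
     (\<forall>D :: (nat, 'a) mc. markov_chain D \<and> aps D = A \<longrightarrow> (sat D (init D) \<Phi> \<longleftrightarrow> sat D (init D) \<Psi>))"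

definition mc_unsat :: "'a set \<Rightarrow> 'a sform \<Rightarrow> bool" where
  "mc_unsat A \<Phi> \<longleftrightarrow> (\<exists>a\<in>A. mc_equiv A \<Phi> (Bot a))"

subsection \<open>Positive normal form\<close>

fun cmp_neg :: "cmp \<Rightarrow> cmp" where
  "cmp_neg Lt = Ge"
| "cmp_neg Gt = Le"
| "cmp_neg Le = Gt"
| "cmp_neg Ge = Lt"

text \<open>
  \<open>pnf True \<Phi>\<close> and \<open>pnf False \<Phi>\<close> are the positive normal forms of \<open>\<Phi>\<close> and of \<open>\<not>\<Phi>\<close>: negations
  remain only in front of atoms and inside the derived connective \<^const>\<open>Or\<close>.
\<close>

primrec pnf :: "bool \<Rightarrow> 'a sform \<Rightarrow> 'a sform"
  and pnf_path :: "'a pform \<Rightarrow> 'a pform" where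
  "pnf b (Atom a) = (if b then Atom a else Neg (Atom a))"
| "pnf b (And \<Phi> \<Psi>) = (if b then And (pnf b \<Phi>) (pnf b \<Psi>) else Or (pnf b \<Phi>) (pnf b \<Psi>))"
| "pnf b (Neg \<Phi>) = pnf (\<not> b) \<Phi>"
| "pnf b (Prob c q \<phi>) = Prob (if b then c else cmp_neg c) q (pnf_path \<phi>)"
| "pnf_path (Next \<Phi>) = Next (pnf True \<Phi>)"
| "pnf_path (Until \<Phi> \<Psi>) = Until (pnf True \<Phi>) (pnf True \<Psi>)"
| "pnf_path (WUntil \<Phi> \<Psi>) = WUntil (pnf True \<Phi>) (pnf True \<Psi>)"

lemma sat_pnf: "sat D s (pnf b \<Phi>) \<longleftrightarrow> (sat D s \<Phi> \<longleftrightarrow> b)"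
  and sat_path_pnf: "sat_path D \<pi> (pnf_path \<phi>) \<longleftrightarrow> sat_path D \<pi> \<phi>"
proof (induction \<Phi> and \<phi> arbitrary: b s and \<pi>)
  case (Prob c q \<phi>)
  then show ?case by (cases c) auto
qed auto

subsection \<open>Safety and liveness fragments\<close>

inductive_set literal :: "'a set \<Rightarrow> 'a sform set" for A where
  "a \<in> A \<Longrightarrow> Atom a \<in> literal A"
| "\<Phi> \<in> literal A \<Longrightarrow> Neg \<Phi> \<in> literal A"
| "\<lbrakk>\<Phi> \<in> literal A; \<Psi> \<in> literal A\<rbrakk> \<Longrightarrow> And \<Phi> \<Psi> \<in> literal A"

text \<open>
  In the last clause the negations \<open>\<not>\<Phi>\<close> and \<open>\<not>\<Psi>\<close> are taken in positive normal form; read purely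
  syntactically, \<open>\<not>\<Phi>\<close> could only be a literal formula or a disjunction.
\<close>

inductive_set safe :: "'a set \<Rightarrow> 'a sform set" for A where
  "\<Phi> \<in> literal A \<Longrightarrow> \<Phi> \<in> safe A"
| "\<lbrakk>\<Phi> \<in> safe A; q \<in> {0..1}\<rbrakk> \<Longrightarrow> Prob Ge q (Next \<Phi>) \<in> safe A"
| "\<lbrakk>\<Phi> \<in> safe A; \<Psi> \<in> safe A\<rbrakk> \<Longrightarrow> And \<Phi> \<Psi> \<in> safe A"
| "\<lbrakk>\<Phi> \<in> safe A; \<Psi> \<in> safe A\<rbrakk> \<Longrightarrow> Or \<Phi> \<Psi> \<in> safe A"
| "\<lbrakk>\<Phi> \<in> safe A; \<Psi> \<in> safe A; q \<in> {0..1}\<rbrakk> \<Longrightarrow> Prob Ge q (WUntil \<Phi> \<Psi>) \<in> safe A"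
| "\<lbrakk>pnf False \<Phi> \<in> safe A; pnf False \<Psi> \<in> safe A; q \<in> {0..1}\<rbrakk> \<Longrightarrow> Prob Le q (Until \<Phi> \<Psi>) \<in> safe A"

text \<open>
  The requirement that no formula equivalent to \<open>\<bottom>\<close> is a liveness formula would contradict the
  unrestricted closure clauses, because \<open>\<bottom>\<close> is equivalent to the instance of the second clause with
  an unsatisfiable literal formula and a positive bound. So it is a side condition on every clause.
\<close>

inductive_set live_lt :: "'a set \<Rightarrow> 'a sform set" for A where
  "a \<in> A \<Longrightarrow> Top a \<in> live_lt A"
| "\<lbrakk>\<Phi> \<in> literal A; a \<in> A; q \<in> {0..1}; \<not> mc_unsat A (Prob Ge q (Until (Top a) \<Phi>))\<rbrakk>
     \<Longrightarrow> Prob Ge q (Until (Top a) \<Phi>) \<in> live_lt A"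
| "\<lbrakk>\<Phi> \<in> live_lt A; \<Psi> \<in> live_lt A; \<not> mc_unsat A (And \<Phi> \<Psi>)\<rbrakk> \<Longrightarrow> And \<Phi> \<Psi> \<in> live_lt A"
| "\<lbrakk>\<Phi> \<in> live_lt A \<or> \<Psi> \<in> live_lt A; pctl A \<Phi>; pctl A \<Psi>; \<not> mc_unsat A (Or \<Phi> \<Psi>)\<rbrakk>
     \<Longrightarrow> Or \<Phi> \<Psi> \<in> live_lt A"
| "\<lbrakk>\<Phi> \<in> live_lt A \<or> \<Psi> \<in> live_lt A; pctl A \<Phi>; pctl A \<Psi>; q \<in> {0..1};
      \<not> mc_unsat A (Prob Ge q (WUntil \<Phi> \<Psi>))\<rbrakk>
     \<Longrightarrow> Prob Ge q (WUntil \<Phi> \<Psi>) \<in> live_lt A"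
| "\<lbrakk>\<Phi> \<in> live_lt A; q \<in> {0..1}; \<not> mc_unsat A (Prob Ge q (Next \<Phi>))\<rbrakk>
     \<Longrightarrow> Prob Ge q (Next \<Phi>) \<in> live_lt A"
| "\<lbrakk>\<Psi> \<in> live_lt A; pctl A \<Phi>; q \<in> {0..1}; \<not> mc_unsat A (Prob Ge q (Until \<Phi> \<Psi>))\<rbrakk>
     \<Longrightarrow> Prob Ge q (Until \<Phi> \<Psi>) \<in> live_lt A"

inductive_set live_gt :: "'a set \<Rightarrow> 'a sform set" for A where
  "a \<in> A \<Longrightarrow> Top a \<in> live_gt A"
| "\<lbrakk>\<Phi> \<in> literal A; a \<in> A; q \<in> {0..1}; \<not> mc_unsat A (Prob Ge q (Until (Top a) \<Phi>))\<rbrakk>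
     \<Longrightarrow> Prob Ge q (Until (Top a) \<Phi>) \<in> live_gt A"
| "\<lbrakk>\<Phi> \<in> live_gt A; \<Psi> \<in> live_gt A; \<not> mc_unsat A (And \<Phi> \<Psi>)\<rbrakk> \<Longrightarrow> And \<Phi> \<Psi> \<in> live_gt A"
| "\<lbrakk>\<Phi> \<in> live_gt A \<or> \<Psi> \<in> live_gt A; pctl A \<Phi>; pctl A \<Psi>; \<not> mc_unsat A (Or \<Phi> \<Psi>)\<rbrakk>
     \<Longrightarrow> Or \<Phi> \<Psi> \<in> live_gt A"
| "\<lbrakk>\<Phi> \<in> live_gt A \<or> \<Psi> \<in> live_gt A; pctl A \<Phi>; pctl A \<Psi>; q \<in> {0..1};
      \<not> mc_unsat A (Prob Ge q (WUntil \<Phi> \<Psi>))\<rbrakk>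
     \<Longrightarrow> Prob Ge q (WUntil \<Phi> \<Psi>) \<in> live_gt A"
| "\<lbrakk>\<Phi> \<in> live_gt A; q \<in> {0..1}; \<not> mc_unsat A (Prob Ge q (Next \<Phi>))\<rbrakk>
     \<Longrightarrow> Prob Ge q (Next \<Phi>) \<in> live_gt A"
| "\<lbrakk>\<Phi> \<in> live_gt A \<or> \<Psi> \<in> live_gt A; pctl A \<Phi>; pctl A \<Psi>; q \<in> {0..1};
      \<not> mc_unsat A (Prob Ge q (Until \<Phi> \<Psi>))\<rbrakk>
     \<Longrightarrow> Prob Ge q (Until \<Phi> \<Psi>) \<in> live_gt A"

section \<open>Strong simulation and the logical preorders\<close>

definition weight_function ::
  "'s set \<Rightarrow> ('s \<times> 's) set \<Rightarrow> 's pmf \<Rightarrow> 's pmf \<Rightarrow> ('s \<times> 's \<Rightarrow> real) \<Rightarrow> bool" where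
  "weight_function S R \<mu>1 \<mu>2 \<Delta> \<longleftrightarrow>
     (\<forall>s1\<in>S. \<forall>s2\<in>S. \<Delta> (s1, s2) \<in> {0..1} \<and> (\<Delta> (s1, s2) > 0 \<longrightarrow> (s1, s2) \<in> R)) \<and>
     (\<forall>s1\<in>S. ((\<lambda>s2. \<Delta> (s1, s2)) has_sum pmf \<mu>1 s1) S) \<and>
     (\<forall>s2\<in>S. ((\<lambda>s1. \<Delta> (s1, s2)) has_sum pmf \<mu>2 s2) S)"

definition strong_simulation :: "('s, 'a) mc \<Rightarrow> ('s \<times> 's) set \<Rightarrow> bool" where
  "strong_simulation D R \<longleftrightarrow>
     R \<subseteq> states D \<times> states D \<and>
     (\<forall>(s1, s2)\<in>R. label D s1 = label D s2 \<and>
        (\<exists>\<Delta>. weight_function (states D) R (trans D s1) (trans D s2) \<Delta>))"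

definition sim_le :: "('s, 'a) mc \<Rightarrow> ('s \<times> 's) set" where
  "sim_le D = {(s1, s2). \<exists>R. strong_simulation D R \<and> (s1, s2) \<in> R}"

definition safe_le :: "('s, 'a) mc \<Rightarrow> ('s \<times> 's) set" where
  "safe_le D = {(s1, s2) \<in> states D \<times> states D. \<forall>\<Phi>\<in>safe (aps D). sat D s2 \<Phi> \<longrightarrow> sat D s1 \<Phi>}"

definition live1_le :: "('s, 'a) mc \<Rightarrow> ('s \<times> 's) set" where
  "live1_le D = {(s1, s2) \<in> states D \<times> states D. \<forall>\<Phi>\<in>live_lt (aps D). sat D s1 \<Phi> \<longrightarrow> sat D s2 \<Phi>}"

definition live2_le :: "('s, 'a) mc \<Rightarrow> ('s \<times> 's) set" where
  "live2_le D = {(s1, s2) \<in> states D \<times> states D. \<forall>\<Phi>\<in>live_gt (aps D). sat D s1 \<Phi> \<longrightarrow> sat D s2 \<Phi>}"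

end

theory Submission
  imports Defs
begin

text \<open>
  Transition probabilities add up to one, so all relations but the last collapse to probabilistic
  bisimilarity, the limit of the equivalences \<open>\<sim>\<^sub>n\<close> which compare labels and the probabilities of
  \<open>\<sim>\<^sub>n\<^sub>-\<^sub>1\<close>-classes. A weight function supported in an equivalence relation gives equal mass to its
  classes, so a simulation is contained in every \<open>\<sim>\<^sub>n\<close>. Conversely, bisimilarity preserves all PCTL
  formulas. If two states differ in the probability of a union of \<open>\<sim>\<^sub>n\<close>-classes, then (passing to
  the complement if necessary) the difference has the sign that a safety formula
  \<open>\<P>\<^sub>\<ge>\<^sub>q(X \<Phi>)\<close> can detect. For the larger liveness fragment, some satisfiable liveness formula holds
  nowhere in a given countable chain, and disjunctions with it make all of PCTL available. The
  smaller liveness fragment cannot distinguish the two states of a deterministic cycle of length two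
  with different labels.
\<close>

section \<open>Finite prefixes of paths\<close>

text \<open>The whole space is the cylinder over the empty set of coordinates, so its mass is that
  of a finite-dimensional marginal.\<close>

lemma prob_space_path_measure: "prob_space (path_measure K s)"
proof -
  let ?M = "\<lambda>_::nat. count_space (UNIV :: 'a set)"
  interpret Ionescu_Tulcea "path_kernel K s" ?M
    by (rule Ionescu_Tulcea_path_kernel)
  let ?X = "space (PiM {0..<0} ?M)"
  have "(UNIV :: (nat \<Rightarrow> 'a) set) = PF.emb UNIV {0..<0} ?X"
    by (auto simp: prod_emb_def space_PiM)
  then have "emeasure (path_measure K s) UNIV = emeasure (CI {0..<0}) ?X"
    unfolding path_measure_def using lim[of "{0..<0}" ?X] by simp
  also have "\<dots> = 1"
    using prob_space.emeasure_space_1[OF PF.prob_space_P[of "{0..<0}"]] by (simp add: PF.space_P)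
  finally show ?thesis
    by (intro prob_spaceI) simp
qed

lemma pred_path_component [measurable]:
  "Measurable.pred (path_measure K s) (\<lambda>\<pi>. P (\<pi> i))" for i :: nat
  unfolding measurable_cong_sets[OF sets_path_measure refl]
  by (rule measurable_compose[OF measurable_component_singleton]) auto

text \<open>The law of the first \<open>Suc n\<close> states as a discrete distribution. On such
  distributions \<open>rel_pmf\<close> provides couplings, which the path measure itself does not
  offer directly.\<close>

primrec walk :: "('s \<Rightarrow> 's pmf) \<Rightarrow> nat \<Rightarrow> 's \<Rightarrow> 's list pmf" where
  "walk K 0 s = return_pmf [s]"
| "walk K (Suc n) s = bind_pmf (K s) (\<lambda>t. map_pmf ((#) s) (walk K n t))"

lemma length_walk: "w \<in> set_pmf (walk K n s) \<Longrightarrow> length w = Suc n"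
  by (induction n arbitrary: s w) auto

lemma map_upt_Suc_Cons: "map w [0..<Suc n] = w 0 # map (\<lambda>i. w (Suc i)) [0..<n]"
proof -
  have "map w [0..<Suc n] = map w (0 # map Suc [0..<n])"
    by (simp only: map_Suc_upt upt_conv_Cons[of 0 "Suc n"] zero_less_Suc)
  then show ?thesis
    by (simp add: comp_def)
qed

lemma pmf_walk:
  "pmf (walk K n s) (map w [0..<Suc n]) = of_bool (w 0 = s) * (\<Prod>i<n. pmf (K (w i)) (w (Suc i)))"
proof (induction n arbitrary: s w)
  case 0
  then show ?case by (auto simp: pmf_return)
next
  case (Suc n)
  let ?w = "\<lambda>i. w (Suc i)"
  let ?p = "\<Prod>i<n. pmf (K (?w i)) (?w (Suc i))"
  have step: "pmf (map_pmf ((#) s) (walk K n t)) (map w [0..<Suc (Suc n)]) =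
      of_bool (w 0 = s) * (of_bool (w 1 = t) * ?p)" for t
  proof (cases "w 0 = s")
    case True
    have "pmf (map_pmf ((#) s) (walk K n t)) (s # map ?w [0..<Suc n]) =
        pmf (walk K n t) (map ?w [0..<Suc n])"
      by (rule pmf_map_inj') auto
    then show ?thesis
      unfolding map_upt_Suc_Cons[of w "Suc n"] Suc.IH[of t ?w] using True by simp
  next
    case False
    then have "pmf (map_pmf ((#) s) (walk K n t)) (w 0 # map ?w [0..<Suc n]) = 0"
      by (subst pmf_eq_0_set_pmf) auto
    then show ?thesis
      unfolding map_upt_Suc_Cons[of w "Suc n"] using False by simp
  qed
  have "pmf (walk K (Suc n) s) (map w [0..<Suc (Suc n)]) =
      (\<integral>t. of_bool (w 0 = s) * (of_bool (w 1 = t) * ?p) \<partial>K s)"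
    by (simp only: walk.simps pmf_bind step)
  \<comment> \<open>Only the successor \<open>t = w 1\<close> contributes to the integral.\<close>
  also have "\<dots> = (\<Sum>t\<in>{w 1}. of_bool (w 0 = s) * (of_bool (w 1 = t) * ?p) * pmf (K s) t)"
    by (rule integral_measure_pmf_real) (auto split: if_splits)
  also have "\<dots> = of_bool (w 0 = s) * (\<Prod>i<Suc n. pmf (K (w i)) (w (Suc i)))"
    unfolding prod.lessThan_Suc_shift by simp
  finally show ?case .
qed

lemma emeasure_path_prefix:
  assumes "length w = Suc n"
  shows "{\<pi>. map \<pi> [0..<Suc n] = w} \<in> sets (path_measure K s)"
    and "emeasure (path_measure K s) {\<pi>. map \<pi> [0..<Suc n] = w} = ennreal (pmf (walk K n s) w)"
proof -
  have w: "map (\<lambda>i. w ! i) [0..<Suc n] = w"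
    using assms map_nth[of w] by simp
  have eq: "{\<pi>. map \<pi> [0..<Suc n] = w} = {\<pi>. \<forall>i\<le>n. \<pi> i = w ! i}"
    using assms by (auto simp: list_eq_iff_nth_eq less_Suc_eq_le simp del: upt_Suc)
  have "Measurable.pred (path_measure K s) (\<lambda>\<pi>. \<forall>i\<le>n. \<pi> i = w ! i)"
    by measurable
  then show "{\<pi>. map \<pi> [0..<Suc n] = w} \<in> sets (path_measure K s)"
    unfolding eq by (simp add: pred_def)
  show "emeasure (path_measure K s) {\<pi>. map \<pi> [0..<Suc n] = w} = ennreal (pmf (walk K n s) w)"
    unfolding eq emeasure_path_cylinder pmf_walk[symmetric] w ..
qed

text \<open>Cutting \<open>W\<close> down to the countable support of the walk leaves its mass
  unchanged and makes the prefix event a countable disjoint union of cylinders. The discarded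
  prefixes can only enlarge the event on the right.\<close>

lemma prob_walk_le_prefix:
  assumes "{\<pi>. map \<pi> [0..<Suc n] \<in> W} \<in> sets (path_measure K s)"
  shows "measure_pmf.prob (walk K n s) W \<le> measure (path_measure K s) {\<pi>. map \<pi> [0..<Suc n] \<in> W}"
proof -
  interpret prob_space "path_measure K s"
    by (rule prob_space_path_measure)
  let ?W = "W \<inter> set_pmf (walk K n s)"
  let ?X = "\<lambda>w. {\<pi>. map \<pi> [0..<Suc n] = w}"
  have "emeasure (walk K n s) W = emeasure (walk K n s) ?W"
    by (rule emeasure_Int_set_pmf[symmetric])
  also have "\<dots> = (\<integral>\<^sup>+ w. pmf (walk K n s) w \<partial>count_space ?W)"
    by (rule nn_integral_pmf[symmetric])
  also have "\<dots> = (\<integral>\<^sup>+ w. emeasure (path_measure K s) (?X w) \<partial>count_space ?W)"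
    by (intro nn_integral_cong) (use emeasure_path_prefix(2) length_walk in force)
  also have "\<dots> = emeasure (path_measure K s) (\<Union>w\<in>?W. ?X w)"
    by (rule emeasure_UN_countable[symmetric])
       (auto intro!: emeasure_path_prefix(1) countable_Int2 dest: length_walk
             simp: disjoint_family_on_def simp del: upt_Suc)
  also have "\<dots> \<le> emeasure (path_measure K s) {\<pi>. map \<pi> [0..<Suc n] \<in> W}"
    by (rule emeasure_mono[OF _ assms]) auto
  finally show ?thesis
    by (simp add: emeasure_eq_measure measure_pmf.emeasure_eq_measure)
qed

text \<open>
  Prefixes are not a measurable function into the discrete space of lists if the state type is
  uncountable, so the two probabilities are compared event by event: the inequality for an event
  and for its complement gives equality.
\<close>

lemma prob_path_prefix:
  assumes "{\<pi>. map \<pi> [0..<Suc n] \<in> W} \<in> sets (path_measure K s)"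
  shows "measure (path_measure K s) {\<pi>. map \<pi> [0..<Suc n] \<in> W} = measure_pmf.prob (walk K n s) W"
proof -
  interpret prob_space "path_measure K s"
    by (rule prob_space_path_measure)
  have compl: "{\<pi>. map \<pi> [0..<Suc n] \<in> - W} = space (path_measure K s) - {\<pi>. map \<pi> [0..<Suc n] \<in> W}"
    by auto
  have "measure_pmf.prob (walk K n s) (- W) \<le> measure (path_measure K s) {\<pi>. map \<pi> [0..<Suc n] \<in> - W}"
    by (rule prob_walk_le_prefix) (unfold compl, rule sets.compl_sets[OF assms])
  moreover have "measure_pmf.prob (walk K n s) (- W) = 1 - measure_pmf.prob (walk K n s) W"
    using measure_pmf.prob_compl[of W "walk K n s"] by (simp add: Compl_eq_Diff_UNIV)
  moreover have "measure (path_measure K s) {\<pi>. map \<pi> [0..<Suc n] \<in> - W} =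
      1 - measure (path_measure K s) {\<pi>. map \<pi> [0..<Suc n] \<in> W}"
    unfolding compl by (rule prob_compl[OF assms])
  ultimately show ?thesis
    using prob_walk_le_prefix[OF assms] by linarith
qed

lemma prob_path_Next:
  "measure (path_measure K s) {\<pi>. \<pi> 1 \<in> B} = measure_pmf.prob (K s) B"
proof -
  let ?W = "{w. w ! 1 \<in> B} :: 'a list set"
  have eq: "{\<pi>. \<pi> 1 \<in> B} = {\<pi>. map \<pi> [0..<Suc 1] \<in> ?W}"
    by simp
  have "Measurable.pred (path_measure K s) (\<lambda>\<pi>. \<pi> 1 \<in> B)"
    by measurable
  then have "measure (path_measure K s) {\<pi>. \<pi> 1 \<in> B} = measure_pmf.prob (walk K 1 s) ?W"
    unfolding eq by (intro prob_path_prefix) (simp add: pred_def)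
  also have "walk K 1 s = map_pmf (\<lambda>t. [s, t]) (K s)"
    by (simp add: map_pmf_def bind_return_pmf)
  finally show ?thesis
    by (simp add: vimage_def)
qed

lemma AE_path_start: "AE \<pi> in path_measure K s. \<pi> 0 = s"
proof -
  interpret prob_space "path_measure K s"
    by (rule prob_space_path_measure)
  have "emeasure (path_measure K s) {\<pi>. \<forall>i\<le>0. \<pi> i = s} = 1"
    unfolding emeasure_path_cylinder by simp
  then have "prob {\<pi> \<in> space (path_measure K s). \<pi> 0 = s} = 1"
    by (simp add: emeasure_eq_measure)
  then show ?thesis
    by (subst (asm) prob_Collect_eq_1) measurable
qed

lemma set_walk:
  assumes "\<And>t. t \<in> S \<Longrightarrow> set_pmf (K t) \<subseteq> S" and "s \<in> S" and "w \<in> set_pmf (walk K n s)"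
  shows "set w \<subseteq> S"
  using assms(2,3)
proof (induction n arbitrary: s w)
  case (Suc n)
  then show ?case using assms(1) by fastforce
qed simp

text \<open>Each single coordinate lies in \<open>S\<close> almost surely, by its finite prefix;
  there are only countably many coordinates.\<close>

lemma AE_path_closed:
  assumes "\<And>t. t \<in> S \<Longrightarrow> set_pmf (K t) \<subseteq> S" and "s \<in> S"
  shows "AE \<pi> in path_measure K s. \<forall>i. \<pi> i \<in> S"
proof -
  interpret prob_space "path_measure K s"
    by (rule prob_space_path_measure)
  have "AE \<pi> in path_measure K s. \<pi> n \<in> S" for n
  proof -
    let ?W = "{w. w ! n \<in> S} :: 'a list set"
    have eq: "{\<pi>. \<pi> n \<in> S} = {\<pi>. map \<pi> [0..<Suc n] \<in> ?W}"
      by (simp del: upt_Suc)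
    have m: "Measurable.pred (path_measure K s) (\<lambda>\<pi>. \<pi> n \<in> S)"
      by measurable
    then have "prob {\<pi>. \<pi> n \<in> S} = measure_pmf.prob (walk K n s) ?W"
      unfolding eq by (intro prob_path_prefix) (simp add: pred_def del: upt_Suc)
    also have "\<dots> = 1"
    proof -
      have "w ! n \<in> S" if "w \<in> set_pmf (walk K n s)" for w
        using set_walk[OF assms that] length_walk[OF that] by (auto intro: subsetD)
      then show ?thesis
        by (intro measure_pmf.prob_eq_1[THEN iffD2]) (auto simp: AE_measure_pmf_iff)
    qed
    finally have "prob {\<pi> \<in> space (path_measure K s). \<pi> n \<in> S} = 1"
      by simp
    then show ?thesis
      by (subst (asm) prob_Collect_eq_1) measurable
  qed
  then show ?thesis
    by (simp add: AE_all_countable)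
qed

section \<open>Bisimilarity\<close>

lemma rel_pmf_measure_eq:
  assumes "rel_pmf R p q" and "\<And>x y. R x y \<Longrightarrow> x \<in> A \<longleftrightarrow> y \<in> B"
  shows "measure_pmf.prob p A = measure_pmf.prob q B"
proof -
  from assms(1) obtain pq where pq: "\<And>x y. (x, y) \<in> set_pmf pq \<Longrightarrow> R x y"
    and eq: "p = map_pmf fst pq" "q = map_pmf snd pq"
    by (auto elim: rel_pmf.cases)
  have "measure_pmf.prob pq (fst -` A) = measure_pmf.prob pq (snd -` B)"
    by (intro measure_pmf.finite_measure_eq_AE) (auto simp: AE_measure_pmf_iff dest!: pq assms(2))
  then show ?thesis
    by (simp add: eq)
qed

lemma rel_pmf_iff_classes:
  assumes "equivp R"
  shows "rel_pmf R p q \<longleftrightarrow> (\<forall>x. measure_pmf.prob p {y. R x y} = measure_pmf.prob q {y. R x y})"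
  unfolding rel_pmf_iff_equivp[OF assms] quotient_def by (auto simp: Image_def)

lemma equivp_rel_pmf: "equivp R \<Longrightarrow> equivp (rel_pmf R)"
  unfolding equivp_reflp_symp_transp by (simp add: pmf.rel_reflp pmf.rel_symp pmf.rel_transp)

text \<open>Couplings of single steps are chained into a coupling of whole prefixes that relates
  them position by position.\<close>

lemma rel_pmf_walk:
  assumes "\<And>x y. R x y \<Longrightarrow> rel_pmf R (K x) (K y)" and "R s t"
  shows "rel_pmf (list_all2 R) (walk K n s) (walk K n t)"
  using assms(2)
proof (induction n arbitrary: s t)
  case (Suc n)
  show ?case
    unfolding walk.simps
    by (rule rel_pmf_bindI[OF assms(1)[OF Suc.prems]])
       (auto simp: pmf.rel_map Suc.prems intro: Suc.IH)
qed simp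

text \<open>The event is the increasing union of its step-bounded versions. Each of these depends on
  a finite prefix only, so coupled walks give it equal probability, and the limits agree.\<close>

lemma prob_path_until_bisimulation:
  assumes "\<And>x y. R x y \<Longrightarrow> rel_pmf R (K x) (K y)" and "R s t"
    and P: "\<And>x y. R x y \<Longrightarrow> P x \<longleftrightarrow> P y" and Q: "\<And>x y. R x y \<Longrightarrow> Q x \<longleftrightarrow> Q y"
  shows "measure (path_measure K s) {\<pi>. \<exists>j. Q (\<pi> j) \<and> (\<forall>i<j. P (\<pi> i))} =
         measure (path_measure K t) {\<pi>. \<exists>j. Q (\<pi> j) \<and> (\<forall>i<j. P (\<pi> i))}"
proof -
  let ?A = "\<lambda>n::nat. {\<pi>. \<exists>j\<le>n. Q (\<pi> j) \<and> (\<forall>i<j. P (\<pi> i))}"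
  \<comment> \<open>The bound \<open>j < length w\<close> keeps every access inside the list, since
    related lists of any length have to agree on membership.\<close>
  let ?W = "\<lambda>n. {w. \<exists>j\<le>n. j < length w \<and> Q (w ! j) \<and> (\<forall>i<j. P (w ! i))}"
  have A: "?A n = {\<pi>. map \<pi> [0..<Suc n] \<in> ?W n}" for n
    by (force simp: less_Suc_eq_le simp del: upt_Suc)
  have U: "{\<pi>. \<exists>j. Q (\<pi> j) \<and> (\<forall>i<j. P (\<pi> i))} = (\<Union>n. ?A n)"
    by (rule set_eqI, unfold UN_iff mem_Collect_eq) blast
  have sets: "?A n \<in> sets (path_measure K u)" for n u
  proof -
    have "Measurable.pred (path_measure K u) (\<lambda>\<pi>. \<exists>j\<le>n. Q (\<pi> j) \<and> (\<forall>i<j. P (\<pi> i)))"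
      by measurable
    then show ?thesis by (simp add: pred_def)
  qed
  have lim: "(\<lambda>n. measure (path_measure K u) (?A n)) \<longlonglongrightarrow> measure (path_measure K u) (\<Union>n. ?A n)" for u
  proof -
    interpret prob_space "path_measure K u"
      by (rule prob_space_path_measure)
    show ?thesis
      using sets by (intro finite_Lim_measure_incseq) (auto simp: incseq_def intro: order_trans)
  qed
  have eq: "measure (path_measure K s) (?A n) = measure (path_measure K t) (?A n)" for n
  proof -
    have "measure_pmf.prob (walk K n s) (?W n) = measure_pmf.prob (walk K n t) (?W n)"
    proof (rule rel_pmf_measure_eq[OF rel_pmf_walk[OF assms(1,2)]])
      fix v w assume vw: "list_all2 R v w"
      then have "length v = length w" "\<And>i. i < length w \<Longrightarrow> R (v ! i) (w ! i)"
        by (auto simp: list_all2_conv_all_nth)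
      then show "v \<in> ?W n \<longleftrightarrow> w \<in> ?W n"
        using P Q by (auto, metis less_trans, metis less_trans)
    qed
    then show ?thesis
      using prob_path_prefix[of n "?W n" K] sets[of n] unfolding A by simp
  qed
  show ?thesis
    unfolding U using lim[of s] lim[of t] unfolding eq by (rule LIMSEQ_unique)
qed

text \<open>Duality reduces weak until to the complement of an until event, so the limit argument is
  needed only once.\<close>

lemma wuntil_iff_not_until:
  "(\<exists>j. Q (\<pi> j) \<and> (\<forall>i<j. P (\<pi> i))) \<or> (\<forall>i. P (\<pi> i)) \<longleftrightarrow>
     \<not> (\<exists>j. (\<not> P (\<pi> j) \<and> \<not> Q (\<pi> j)) \<and> (\<forall>i<j. \<not> Q (\<pi> i)))" for \<pi> :: "nat \<Rightarrow> 's"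
proof (cases "\<exists>j. \<not> P (\<pi> j)")
  case True
  \<comment> \<open>\<open>m\<close> is the first position violating \<open>P\<close>; weak until
    then demands \<open>Q\<close> at some position up to \<open>m\<close>.\<close>
  then obtain m where m: "\<not> P (\<pi> m)" "\<And>i. i < m \<Longrightarrow> P (\<pi> i)"
    using exists_least_iff[of "\<lambda>j. \<not> P (\<pi> j)"] by blast
  show ?thesis
  proof
    assume "(\<exists>j. Q (\<pi> j) \<and> (\<forall>i<j. P (\<pi> i))) \<or> (\<forall>i. P (\<pi> i))"
    then show "\<not> (\<exists>j. (\<not> P (\<pi> j) \<and> \<not> Q (\<pi> j)) \<and> (\<forall>i<j. \<not> Q (\<pi> i)))"
      using m(1) by (auto, metis linorder_neqE_nat)
  next
    assume "\<not> (\<exists>j. (\<not> P (\<pi> j) \<and> \<not> Q (\<pi> j)) \<and> (\<forall>i<j. \<not> Q (\<pi> i)))"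
    then obtain j where "j \<le> m" "Q (\<pi> j)"
      using m(1) by (metis le_less order_refl)
    then show "(\<exists>j. Q (\<pi> j) \<and> (\<forall>i<j. P (\<pi> i))) \<or> (\<forall>i. P (\<pi> i))"
      using m(2) by (meson less_le_trans)
  qed
next
  case False
  then show ?thesis by blast
qed

lemma prob_path_wuntil_bisimulation:
  assumes "\<And>x y. R x y \<Longrightarrow> rel_pmf R (K x) (K y)" and "R s t"
    and P: "\<And>x y. R x y \<Longrightarrow> P x \<longleftrightarrow> P y" and Q: "\<And>x y. R x y \<Longrightarrow> Q x \<longleftrightarrow> Q y"
  shows "measure (path_measure K s) {\<pi>. (\<exists>j. Q (\<pi> j) \<and> (\<forall>i<j. P (\<pi> i))) \<or> (\<forall>i. P (\<pi> i))} =
         measure (path_measure K t) {\<pi>. (\<exists>j. Q (\<pi> j) \<and> (\<forall>i<j. P (\<pi> i))) \<or> (\<forall>i. P (\<pi> i))}"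
proof -
  let ?U = "{\<pi>. \<exists>j. (\<not> P (\<pi> j) \<and> \<not> Q (\<pi> j)) \<and> (\<forall>i<j. \<not> Q (\<pi> i))}"
  have compl: "measure (path_measure K u) {\<pi>. \<not> (\<exists>j. (\<not> P (\<pi> j) \<and> \<not> Q (\<pi> j)) \<and> (\<forall>i<j. \<not> Q (\<pi> i)))} =
      1 - measure (path_measure K u) ?U" for u
  proof -
    interpret prob_space "path_measure K u"
      by (rule prob_space_path_measure)
    have "Measurable.pred (path_measure K u) (\<lambda>\<pi>. \<exists>j. (\<not> P (\<pi> j) \<and> \<not> Q (\<pi> j)) \<and> (\<forall>i<j. \<not> Q (\<pi> i)))"
      by measurable
    then have "?U \<in> sets (path_measure K u)"
      by (simp add: pred_def)
    from prob_compl[OF this] show ?thesis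
      by (simp add: set_diff_eq)
  qed
  have "measure (path_measure K s) ?U = measure (path_measure K t) ?U"
    by (rule prob_path_until_bisimulation[OF assms(1,2)]) (auto dest: P Q)
  then show ?thesis
    unfolding wuntil_iff_not_until compl by simp
qed

text \<open>For path formulas the induction has to speak of probabilities: related states start
  different paths, and no two single paths can be compared.\<close>

lemma sat_bisimulation:
  assumes R: "\<And>x y. R x y \<Longrightarrow> label D x = label D y \<and> rel_pmf R (trans D x) (trans D y)"
  shows "R s t \<Longrightarrow> sat D s \<Phi> \<longleftrightarrow> sat D t \<Phi>"
    and "R s t \<Longrightarrow> measure (path_measure (trans D) s) {\<pi>. sat_path D \<pi> \<phi>} =
                  measure (path_measure (trans D) t) {\<pi>. sat_path D \<pi> \<phi>}"
proof (induction \<Phi> and \<phi> arbitrary: s t and s t)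
  case (Atom a)
  then show ?case using R by simp
next
  case (And \<Phi> \<Psi>)
  then show ?case unfolding sat.simps by blast
next
  case (Neg \<Phi>)
  then show ?case unfolding sat.simps by blast
next
  case (Prob c q \<phi>)
  show ?case using Prob.IH[OF Prob.prems] by simp
next
  case (Next \<Phi>)
  have "measure_pmf.prob (trans D s) {u. sat D u \<Phi>} = measure_pmf.prob (trans D t) {u. sat D u \<Phi>}"
    using R[OF Next.prems] Next.IH by (intro rel_pmf_measure_eq[of R]) blast+
  then show ?case
    using prob_path_Next[of "trans D" _ "{u. sat D u \<Phi>}"] by simp
next
  case (Until \<Phi> \<Psi>)
  show ?case
    unfolding sat_path.simps
    by (rule prob_path_until_bisimulation[of R, OF _ Until.prems Until.IH]) (use R in blast)
next
  case (WUntil \<Phi> \<Psi>)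
  show ?case
    unfolding sat_path.simps
    by (rule prob_path_wuntil_bisimulation[of R, OF _ WUntil.prems WUntil.IH]) (use R in blast)
qed

section \<open>Bisimilarity as the limit of finite approximants\<close>

primrec bis :: "('s, 'a) mc \<Rightarrow> nat \<Rightarrow> 's \<Rightarrow> 's \<Rightarrow> bool" where
  "bis D 0 s t \<longleftrightarrow> label D s = label D t"
| "bis D (Suc n) s t \<longleftrightarrow> label D s = label D t \<and> rel_pmf (bis D n) (trans D s) (trans D t)"

definition bisim :: "('s, 'a) mc \<Rightarrow> 's \<Rightarrow> 's \<Rightarrow> bool" where
  "bisim D s t \<longleftrightarrow> (\<forall>n. bis D n s t)"

lemma equivp_bis: "equivp (bis D n)"
proof (induction n)
  case 0
  then show ?case by (auto simp: equivp_def fun_eq_iff)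
next
  case (Suc n)
  then have "equivp (rel_pmf (bis D n))"
    by (rule equivp_rel_pmf)
  then show ?case
    unfolding equivp_reflp_symp_transp reflp_def symp_def transp_def bis.simps by blast
qed

lemma equivp_bisim: "equivp (bisim D)"
proof (rule equivpI)
  show "reflp (bisim D)"
    using equivp_reflp[OF equivp_bis] by (auto simp: reflp_def bisim_def)
  show "symp (bisim D)"
    unfolding symp_def bisim_def by (blast intro: equivp_symp[OF equivp_bis])
  show "transp (bisim D)"
    unfolding transp_def bisim_def by (metis equivp_transp[OF equivp_bis])
qed

lemma bis_Suc_imp: "bis D (Suc n) s t \<Longrightarrow> bis D n s t"
  by (induction n arbitrary: s t) (auto elim!: pmf.rel_mono_strong)

lemma bis_antimono: "m \<le> n \<Longrightarrow> bis D n s t \<Longrightarrow> bis D m s t"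
proof (induction rule: dec_induct)
  case (step n)
  then show ?case by (metis bis_Suc_imp)
qed

lemma bisim_imp_label: "bisim D s t \<Longrightarrow> label D s = label D t"
  unfolding bisim_def by (drule spec[of _ 0]) simp

text \<open>The limit is itself a bisimulation: a class of \<open>bisim D\<close> is the decreasing
  intersection of the classes of \<open>bis D n\<close>, so continuity from above carries the
  equality of class masses to the limit.\<close>

lemma bisim_imp_rel_pmf:
  assumes "bisim D s t"
  shows "rel_pmf (bisim D) (trans D s) (trans D t)"
  unfolding rel_pmf_iff_classes[OF equivp_bisim]
proof
  fix x
  have cls: "{y. bisim D x y} = (\<Inter>n. {y. bis D n x y})"
    by (auto simp: bisim_def)
  have lim: "(\<lambda>n. measure_pmf.prob p {y. bis D n x y}) \<longlonglongrightarrow> measure_pmf.prob p {y. bisim D x y}" for p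
    unfolding cls
    by (intro measure_pmf.finite_Lim_measure_decseq) (auto simp: decseq_def intro: bis_antimono)
  have "measure_pmf.prob (trans D s) {y. bis D n x y} = measure_pmf.prob (trans D t) {y. bis D n x y}" for n
    using assms rel_pmf_iff_classes[OF equivp_bis, of D n] unfolding bisim_def
    by (metis bis.simps(2))
  then show "measure_pmf.prob (trans D s) {y. bisim D x y} = measure_pmf.prob (trans D t) {y. bisim D x y}"
    using lim[of "trans D s"] lim[of "trans D t"] by (auto intro: LIMSEQ_unique)
qed

lemma bisim_sat: "bisim D s t \<Longrightarrow> sat D s \<Phi> \<longleftrightarrow> sat D t \<Phi>"
  by (rule sat_bisimulation(1)[of "bisim D"]) (intro conjI bisim_imp_label bisim_imp_rel_pmf)

section \<open>Simulation is bisimilarity\<close>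

lemma nn_integral_count_space_has_sum:
  fixes f :: "'b \<Rightarrow> real"
  assumes "(f has_sum x) A" and "\<And>a. a \<in> A \<Longrightarrow> 0 \<le> f a"
  shows "(\<integral>\<^sup>+a. ennreal (f a) \<partial>count_space A) = ennreal x"
proof -
  have summable: "Infinite_Set_Sum.abs_summable_on f A"
    using summable_on_iff_abs_summable_on_real[THEN iffD1, OF has_sum_imp_summable[OF assms(1)]]
    by (simp only: abs_summable_equivalent)
  then have "(\<integral>\<^sup>+a. ennreal (f a) \<partial>count_space A) = ennreal (infsetsum f A)"
    using assms(2) by (rule nn_integral_conv_infsetsum)
  then show ?thesis
    using infsumI[OF assms(1)] by (simp add: infsetsum_infsum[OF summable])
qed

lemma has_sum_pmf: "(pmf p has_sum measure_pmf.prob p A) A"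
proof -
  have "Infinite_Set_Sum.abs_summable_on (pmf p) A"
    by (rule pmf_abs_summable)
  moreover from this have "pmf p summable_on A"
    by (rule summable_on_iff_abs_summable_on_real[THEN iffD2, OF abs_summable_equivalent[THEN iffD2]])
  ultimately show ?thesis
    unfolding measure_pmf_conv_infsetsum by (simp add: infsetsum_infsum has_sum_infsum)
qed

text \<open>Both sides are the double sum of \<open>\<Delta>\<close> over the pairs whose first,
  respectively second, component lies in \<open>B\<close>. Nonnegative integrals over counting
  measures allow the two sums to be exchanged.\<close>

lemma weight_function_prob_eq:
  assumes "countable S" and "set_pmf p \<subseteq> S" and "set_pmf q \<subseteq> S"
    and wf: "weight_function S R p q \<Delta>"
    and B: "\<And>u v. (u, v) \<in> R \<Longrightarrow> u \<in> B \<longleftrightarrow> v \<in> B"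
  shows "measure_pmf.prob p B = measure_pmf.prob q B"
proof -
  have \<Delta>: "0 \<le> \<Delta> (u, v)" "\<Delta> (u, v) \<noteq> 0 \<Longrightarrow> u \<in> B \<longleftrightarrow> v \<in> B" if "u \<in> S" "v \<in> S" for u v
    using wf that B[of u v] by (auto simp: weight_function_def less_le)
  have *: "emeasure (measure_pmf r) B = (\<integral>\<^sup>+u. ennreal (pmf r u) * indicator B u \<partial>count_space S)"
    if "set_pmf r \<subseteq> S" for r
  proof -
    have "emeasure (measure_pmf r) B = (\<integral>\<^sup>+u. indicator B u \<partial>measure_pmf r)"
      by simp
    also have "\<dots> = (\<integral>\<^sup>+u. ennreal (pmf r u) * indicator B u \<partial>count_space UNIV)"
      by (rule nn_integral_measure_pmf)
    also have "\<dots> = (\<integral>\<^sup>+u. ennreal (pmf r u) * indicator B u \<partial>count_space S)"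
      using that by (intro nn_integral_count_space_eq) (auto simp: set_pmf_iff)
    finally show ?thesis .
  qed
  have "emeasure (measure_pmf p) B =
      (\<integral>\<^sup>+u. (\<integral>\<^sup>+v. ennreal (\<Delta> (u, v)) \<partial>count_space S) * indicator B u \<partial>count_space S)"
    unfolding *[OF assms(2)]
  proof (rule nn_integral_cong)
    fix u assume "u \<in> space (count_space S)"
    then have u: "u \<in> S" by simp
    then have "((\<lambda>v. \<Delta> (u, v)) has_sum pmf p u) S"
      using wf by (simp add: weight_function_def)
    from nn_integral_count_space_has_sum[OF this] u
    show "ennreal (pmf p u) * indicator B u = (\<integral>\<^sup>+v. ennreal (\<Delta> (u, v)) \<partial>count_space S) * indicator B u"
      by (simp add: \<Delta>)
  qed
  also have "\<dots> = (\<integral>\<^sup>+u. (\<integral>\<^sup>+v. ennreal (\<Delta> (u, v)) * indicator B u \<partial>count_space S) \<partial>count_space S)"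
    by (simp add: nn_integral_multc)
  \<comment> \<open>The weight vanishes on pairs that \<open>B\<close> separates, so the indicator
    may move from \<open>u\<close> to \<open>v\<close>.\<close>
  also have "\<dots> = (\<integral>\<^sup>+u. (\<integral>\<^sup>+v. ennreal (\<Delta> (u, v)) * indicator B v \<partial>count_space S) \<partial>count_space S)"
    by (intro nn_integral_cong) (use \<Delta>(2) in \<open>force simp: indicator_def\<close>)
  also have "\<dots> = (\<integral>\<^sup>+v. (\<integral>\<^sup>+u. ennreal (\<Delta> (u, v)) * indicator B v \<partial>count_space S) \<partial>count_space S)"
    by (rule nn_integral_count_space_nn_integral[OF assms(1)]) simp
  also have "\<dots> = (\<integral>\<^sup>+v. (\<integral>\<^sup>+u. ennreal (\<Delta> (u, v)) \<partial>count_space S) * indicator B v \<partial>count_space S)"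
    by (simp add: nn_integral_multc)
  also have "\<dots> = emeasure (measure_pmf q) B"
    unfolding *[OF assms(3)]
  proof (rule nn_integral_cong)
    fix v assume "v \<in> space (count_space S)"
    then have v: "v \<in> S" by simp
    then have "((\<lambda>u. \<Delta> (u, v)) has_sum pmf q v) S"
      using wf by (simp add: weight_function_def)
    from nn_integral_count_space_has_sum[OF this] v
    show "(\<integral>\<^sup>+u. ennreal (\<Delta> (u, v)) \<partial>count_space S) * indicator B v = ennreal (pmf q v) * indicator B v"
      by (simp add: \<Delta>)
  qed
  finally show ?thesis
    by (simp add: measure_pmf.emeasure_eq_measure)
qed

text \<open>The mass function of a coupling serves as weight function: its row and column sums are
  the two marginals, and its support lies in \<open>S\<close> times \<open>S\<close>.\<close>

lemma rel_pmf_imp_weight_function: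
  assumes "rel_pmf P p q" and "set_pmf p \<subseteq> S" and "set_pmf q \<subseteq> S"
  shows "\<exists>\<Delta>. weight_function S {(u, v) \<in> S \<times> S. P u v} p q \<Delta>"
proof -
  from assms(1) obtain pq where pq: "\<And>x y. (x, y) \<in> set_pmf pq \<Longrightarrow> P x y"
    and eq: "map_pmf fst pq = p" "map_pmf snd pq = q"
    by (auto elim: rel_pmf.cases)
  have supp: "u \<in> S \<and> v \<in> S" if "(u, v) \<in> set_pmf pq" for u v
    using that assms(2,3) unfolding eq[symmetric] by force
  have p: "((\<lambda>v. pmf pq (u, v)) has_sum pmf p u) S" for u
  proof -
    have "(pmf pq has_sum measure_pmf.prob pq ({u} \<times> S)) (Pair u ` S)"
      using has_sum_pmf[of pq "{u} \<times> S"] by (rule back_subst[of "(has_sum) _ _"]) auto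
    then have "((pmf pq \<circ> Pair u) has_sum measure_pmf.prob pq ({u} \<times> S)) S"
      by (subst (asm) has_sum_reindex) (auto intro: inj_onI)
    moreover have "measure_pmf.prob pq ({u} \<times> S) = pmf p u"
      unfolding eq(1)[symmetric] pmf_map
      by (intro measure_pmf.finite_measure_eq_AE) (auto simp: AE_measure_pmf_iff dest: supp)
    ultimately show ?thesis by (simp add: comp_def)
  qed
  have q: "((\<lambda>u. pmf pq (u, v)) has_sum pmf q v) S" for v
  proof -
    have "(pmf pq has_sum measure_pmf.prob pq (S \<times> {v})) ((\<lambda>u. (u, v)) ` S)"
      using has_sum_pmf[of pq "S \<times> {v}"] by (rule back_subst[of "(has_sum) _ _"]) auto
    then have "((pmf pq \<circ> (\<lambda>u. (u, v))) has_sum measure_pmf.prob pq (S \<times> {v})) S"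
      by (subst (asm) has_sum_reindex) (auto intro: inj_onI)
    moreover have "measure_pmf.prob pq (S \<times> {v}) = pmf q v"
      unfolding eq(2)[symmetric] pmf_map
      by (intro measure_pmf.finite_measure_eq_AE) (auto simp: AE_measure_pmf_iff dest: supp)
    ultimately show ?thesis by (simp add: comp_def)
  qed
  have "weight_function S {(u, v) \<in> S \<times> S. P u v} p q (pmf pq)"
    using p q pq by (auto simp: weight_function_def pmf_le_1 pmf_positive_iff)
  then show ?thesis by blast
qed

text \<open>\<open>R\<close> need not be symmetric. By induction it lies inside the equivalence
  \<open>bis D n\<close>, so related states share a class, and the weight function forces equal
  class masses.\<close>

lemma sim_imp_bis:
  assumes "markov_chain D" and R: "strong_simulation D R" and "(s, t) \<in> R"
  shows "bis D n s t"
  using assms(3)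
proof (induction n arbitrary: s t)
  case 0
  then show ?case
    using R by (auto simp: strong_simulation_def)
next
  case (Suc n)
  have st: "s \<in> states D" "t \<in> states D" and lab: "label D s = label D t"
    using R Suc.prems by (auto simp: strong_simulation_def)
  obtain \<Delta> where \<Delta>: "weight_function (states D) R (trans D s) (trans D t) \<Delta>"
    using R Suc.prems by (fastforce simp: strong_simulation_def)
  have "measure_pmf.prob (trans D s) {y. bis D n x y} = measure_pmf.prob (trans D t) {y. bis D n x y}" for x
  proof (rule weight_function_prob_eq[OF _ _ _ \<Delta>])
    fix u v assume "(u, v) \<in> R"
    then have "bis D n u v" by (rule Suc.IH)
    then show "u \<in> {y. bis D n x y} \<longleftrightarrow> v \<in> {y. bis D n x y}"
      using equivp_bis[of D n] by (auto intro: equivp_transp equivp_symp)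
  next
    show "countable (states D)" "set_pmf (trans D s) \<subseteq> states D" "set_pmf (trans D t) \<subseteq> states D"
      using assms(1) st by (simp_all add: markov_chain_def)
  qed
  then show ?case
    using lab by (simp add: rel_pmf_iff_classes[OF equivp_bis])
qed

lemma sim_le_eq_bisim:
  assumes "markov_chain D"
  shows "sim_le D = {(s, t) \<in> states D \<times> states D. bisim D s t}"
proof
  show "sim_le D \<subseteq> {(s, t) \<in> states D \<times> states D. bisim D s t}"
    using sim_imp_bis[OF assms] by (auto simp: sim_le_def bisim_def) (auto simp: strong_simulation_def)
  let ?R = "{(s, t) \<in> states D \<times> states D. bisim D s t}"
  have "strong_simulation D ?R"
    unfolding strong_simulation_def
  proof (intro conjI ballI case_prodI2)
    show "?R \<subseteq> states D \<times> states D"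
      by auto
    fix st s t assume "st \<in> ?R" "st = (s, t)"
    then have st: "s \<in> states D" "t \<in> states D" "bisim D s t"
      by auto
    show "label D s = label D t"
      using st(3) by (rule bisim_imp_label)
    show "\<exists>\<Delta>. weight_function (states D) ?R (trans D s) (trans D t) \<Delta>"
      using assms st
      by (intro rel_pmf_imp_weight_function bisim_imp_rel_pmf) (auto simp: markov_chain_def)
  qed
  then show "?R \<subseteq> sim_le D"
    unfolding sim_le_def by blast
qed

section \<open>Safety formulas separate non-bisimilar states\<close>

lemma finite_INT_closed:
  assumes "\<And>A B. A \<in> \<S> \<Longrightarrow> B \<in> \<S> \<Longrightarrow> A \<inter> B \<in> \<S>"
    and "finite I" and "I \<noteq> {}" and "\<And>i. i \<in> I \<Longrightarrow> f i \<in> \<S>"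
  shows "(\<Inter>i\<in>I. f i) \<in> \<S>"
  using assms(2-) by (induction rule: finite_ne_induct) (simp_all add: assms(1))

lemma finite_UN_closed:
  assumes "\<And>A B. A \<in> \<S> \<Longrightarrow> B \<in> \<S> \<Longrightarrow> A \<union> B \<in> \<S>"
    and "finite I" and "I \<noteq> {}" and "\<And>i. i \<in> I \<Longrightarrow> f i \<in> \<S>"
  shows "(\<Union>i\<in>I. f i) \<in> \<S>"
  using assms(2-) by (induction rule: finite_ne_induct) (simp_all add: assms(1))

text \<open>
  If a lattice of sets separates the points of \<open>B\<close> from those outside \<open>B\<close>, finite unions of finite
  intersections of its members approximate \<open>B\<close> well enough to detect a difference in probability.
\<close>

lemma lattice_detects_prob_less:
  assumes S: "countable S" "set_pmf p \<subseteq> S" "set_pmf q \<subseteq> S"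
    and Int: "\<And>A B. A \<in> \<S> \<Longrightarrow> B \<in> \<S> \<Longrightarrow> A \<inter> B \<in> \<S>"
    and Un: "\<And>A B. A \<in> \<S> \<Longrightarrow> B \<in> \<S> \<Longrightarrow> A \<union> B \<in> \<S>"
    and sep: "\<And>u v. u \<in> S \<inter> B \<Longrightarrow> v \<in> S - B \<Longrightarrow> \<exists>A\<in>\<S>. u \<in> A \<and> v \<notin> A"
    and less: "measure_pmf.prob p B < measure_pmf.prob q B"
  shows "\<exists>A\<in>\<S>. measure_pmf.prob p A < measure_pmf.prob q A"
proof -
  have restr: "measure_pmf.prob r (A \<inter> S) = measure_pmf.prob r A" if "set_pmf r \<subseteq> S" for r A
    using that by (intro measure_pmf.finite_measure_eq_AE) (auto simp: AE_measure_pmf_iff)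
  \<comment> \<open>Both parts of \<open>S\<close> are enumerated below by
    \<open>from_nat_into\<close>, which requires them to be nonempty; the strict inequality excludes
    the degenerate cases.\<close>
  have ne: "S \<inter> B \<noteq> {}"
  proof
    assume "S \<inter> B = {}"
    then have "measure_pmf.prob q B = 0"
      using restr[OF S(3), of B] by (simp add: Int_commute)
    with less show False
      using measure_nonneg[of "measure_pmf p" B] by linarith
  qed
  have ne': "S - B \<noteq> {}"
  proof
    assume "S - B = {}"
    then have "B \<inter> S = S" by auto
    moreover have "measure_pmf.prob p S = 1"
      using S(2) by (intro measure_pmf.prob_eq_1[THEN iffD2]) (auto simp: AE_measure_pmf_iff)
    ultimately have "measure_pmf.prob p B = 1"
      using restr[OF S(2), of B] by simp
    with less show False
      using measure_pmf.prob_le_1[of q B] by linarith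
  qed
  \<comment> \<open>Inner approximation: a finite part of \<open>B\<close> already has more
    \<open>q\<close>-mass than all of \<open>B\<close> has \<open>p\<close>-mass.\<close>
  obtain F where F: "finite F" "F \<noteq> {}" "F \<subseteq> S \<inter> B" "measure_pmf.prob p B < measure_pmf.prob q F"
  proof -
    let ?F = "\<lambda>n. from_nat_into (S \<inter> B) ` {..n}"
    have "(\<Union>n. ?F n) = B \<inter> S"
      using range_from_nat_into[OF ne] S(1) by (auto simp: image_def) blast+
    moreover have "(\<lambda>n. measure_pmf.prob q (?F n)) \<longlonglongrightarrow> measure_pmf.prob q (\<Union>n. ?F n)"
      by (intro measure_pmf.finite_Lim_measure_incseq) (auto simp: incseq_def)
    ultimately have "(\<lambda>n. measure_pmf.prob q (?F n)) \<longlonglongrightarrow> measure_pmf.prob q B"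
      by (simp add: restr[OF S(3)])
    then have "eventually (\<lambda>n. measure_pmf.prob p B < measure_pmf.prob q (?F n)) sequentially"
      using less by (rule order_tendstoD(1))
    then obtain n where "measure_pmf.prob p B < measure_pmf.prob q (?F n)"
      by (auto simp: eventually_sequentially)
    then show ?thesis
      using from_nat_into[OF ne] by (intro that[of "?F n"]) auto
  qed
  obtain A where A: "\<And>u v. u \<in> S \<inter> B \<Longrightarrow> v \<in> S - B \<Longrightarrow> A u v \<in> \<S> \<and> u \<in> A u v \<and> v \<notin> A u v"
    using sep by metis
  define g where "g = from_nat_into (S - B)"
  have g: "g i \<in> S - B" for i
    unfolding g_def by (rule from_nat_into[OF ne'])
  \<comment> \<open>Outer approximation: the stage \<open>n\<close> still contains \<open>F\<close>
    but excludes the outside points \<open>g 0\<close> to \<open>g n\<close>.\<close>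
  let ?E = "\<lambda>n. \<Union>u\<in>F. \<Inter>i\<in>{..n}. A u (g i)"
  have E: "?E n \<in> \<S>" for n
  proof (intro finite_UN_closed[OF Un] finite_INT_closed[OF Int] F(1,2))
    fix u i assume "u \<in> F"
    then show "A u (g i) \<in> \<S>"
      using A[OF _ g[of i], of u] F(3) by blast
  qed simp_all
  \<comment> \<open>A point of \<open>S\<close> outside \<open>B\<close> is some \<open>g k\<close>,
    and stage \<open>k\<close> has removed it.\<close>
  have sub: "(\<Inter>n. ?E n) \<inter> S \<subseteq> B"
  proof
    fix x assume x: "x \<in> (\<Inter>n. ?E n) \<inter> S"
    show "x \<in> B"
    proof (rule ccontr)
      assume "x \<notin> B"
      with x have "x \<in> S - B" by auto
      then obtain k where k: "g k = x"
        using range_from_nat_into[OF ne'] S(1) unfolding g_def by (metis countable_Diff rangeE)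
      from x have "x \<in> ?E k" by blast
      then obtain u where "u \<in> F" "x \<in> A u (g k)" by auto
      then show False
        using A[of u "g k"] g[of k] F(3) k by auto
    qed
  qed
  have "(\<lambda>n. measure_pmf.prob p (?E n)) \<longlonglongrightarrow> measure_pmf.prob p (\<Inter>n. ?E n)"
    by (intro measure_pmf.finite_Lim_measure_decseq) (fastforce simp: decseq_def)+
  moreover have "measure_pmf.prob p (\<Inter>n. ?E n) \<le> measure_pmf.prob p B"
    using measure_pmf.finite_measure_mono[OF sub, of p] by (simp add: restr[OF S(2)])
  ultimately have "eventually (\<lambda>n. measure_pmf.prob p (?E n) < measure_pmf.prob q F) sequentially"
    using order_le_less_trans[OF _ F(4)] by (intro order_tendstoD(2))
  then obtain n where n: "measure_pmf.prob p (?E n) < measure_pmf.prob q F"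
    by (auto simp: eventually_sequentially)
  have "measure_pmf.prob q F \<le> measure_pmf.prob q (?E n)"
  proof (rule measure_pmf.finite_measure_mono)
    have "u \<in> A u (g i)" if "u \<in> F" for u i
      using A[OF _ g[of i], of u] F(3) that by blast
    then show "F \<subseteq> ?E n" by blast
  qed simp
  with n E[of n] show ?thesis
    by (intro bexI[of _ "?E n"]) linarith+
qed

section \<open>Construction of separating safety formulas\<close>

lemma sat_Or: "sat D s (Or \<Phi> \<Psi>) \<longleftrightarrow> sat D s \<Phi> \<or> sat D s \<Psi>"
  by simp

lemma sat_Ge_Next: "sat D s (Prob Ge q (Next \<Phi>)) \<longleftrightarrow> q \<le> measure_pmf.prob (trans D s) {u. sat D u \<Phi>}"
  using prob_path_Next[of "trans D" s "{u. sat D u \<Phi>}"] by simp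

lemma sat_Le_Next: "sat D s (Prob Le q (Next \<Phi>)) \<longleftrightarrow> measure_pmf.prob (trans D s) {u. sat D u \<Phi>} \<le> q"
  using prob_path_Next[of "trans D" s "{u. sat D u \<Phi>}"] by simp

lemma safe_separates_labels:
  assumes "markov_chain D" "s \<in> states D" "t \<in> states D" "label D s \<noteq> label D t"
  shows "\<exists>\<Phi>\<in>safe (aps D). sat D t \<Phi> \<and> \<not> sat D s \<Phi>"
proof -
  have "label D s \<subseteq> aps D" "label D t \<subseteq> aps D"
    using assms by (auto simp: markov_chain_def)
  then obtain a where a: "a \<in> aps D" "a \<in> label D s \<longleftrightarrow> a \<notin> label D t"
    using assms(4) by blast
  then have "Atom a \<in> safe (aps D)" "Neg (Atom a) \<in> safe (aps D)"
    by (auto intro: safe.intros(1) literal.intros)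
  with a(2) show ?thesis
    by (metis sat.simps(1,3))
qed

lemma safe_separates:
  assumes D: "markov_chain D" and "s \<in> states D" "t \<in> states D" "\<not> bis D n s t"
  shows "\<exists>\<Phi>\<in>safe (aps D). sat D t \<Phi> \<and> \<not> sat D s \<Phi>"
  using assms(2-)
proof (induction n arbitrary: s t)
  case 0
  then show ?case
    using safe_separates_labels[OF D] by simp
next
  case (Suc n)
  show ?case
  proof (cases "label D s = label D t")
    case True
    with Suc.prems obtain x
      where x: "measure_pmf.prob (trans D s) {y. bis D n x y} \<noteq> measure_pmf.prob (trans D t) {y. bis D n x y}"
      by (auto simp: rel_pmf_iff_classes[OF equivp_bis])
    \<comment> \<open>Total mass one gives the choice of sign: if the class of \<open>x\<close> has
      larger mass under the successors of \<open>s\<close>, its complement has smaller mass. Both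
      are unions of classes, so the induction hypothesis separates their points from the points
      outside.\<close>
    obtain B where B: "measure_pmf.prob (trans D s) B < measure_pmf.prob (trans D t) B"
        "\<And>u v. u \<in> B \<Longrightarrow> v \<notin> B \<Longrightarrow> \<not> bis D n v u"
    proof (cases "measure_pmf.prob (trans D s) {y. bis D n x y} < measure_pmf.prob (trans D t) {y. bis D n x y}")
      case True
      then show ?thesis
        by (rule that) (use equivp_bis[of D n] in \<open>blast intro: equivp_transp equivp_symp\<close>)
    next
      case False
      have "measure_pmf.prob p (- C) = 1 - measure_pmf.prob p C" for p :: "'a pmf" and C
        using measure_pmf.prob_compl[of C p] by (simp add: Compl_eq_Diff_UNIV)
      with False x have "measure_pmf.prob (trans D s) (- {y. bis D n x y}) <
          measure_pmf.prob (trans D t) (- {y. bis D n x y})"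
        by simp
      then show ?thesis
        by (rule that) (use equivp_bis[of D n] in \<open>blast intro: equivp_transp\<close>)
    qed
    let ?\<S> = "{{u. sat D u \<Phi>} |\<Phi>. \<Phi> \<in> safe (aps D)}"
    have "\<exists>A\<in>?\<S>. measure_pmf.prob (trans D s) A < measure_pmf.prob (trans D t) A"
    proof (rule lattice_detects_prob_less[OF _ _ _ _ _ _ B(1)])
      show "countable (states D)" "set_pmf (trans D s) \<subseteq> states D" "set_pmf (trans D t) \<subseteq> states D"
        using D Suc.prems by (auto simp: markov_chain_def)
      fix A1 A2 assume "A1 \<in> ?\<S>" "A2 \<in> ?\<S>"
      then obtain \<Phi>1 \<Phi>2 where \<Phi>: "A1 = {u. sat D u \<Phi>1}" "A2 = {u. sat D u \<Phi>2}"
          "\<Phi>1 \<in> safe (aps D)" "\<Phi>2 \<in> safe (aps D)"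
        by blast
      have "A1 \<inter> A2 = {u. sat D u (And \<Phi>1 \<Phi>2)}" "A1 \<union> A2 = {u. sat D u (Or \<Phi>1 \<Phi>2)}"
        unfolding \<Phi> by auto
      then show "A1 \<inter> A2 \<in> ?\<S>" "A1 \<union> A2 \<in> ?\<S>"
        using safe.intros(3,4)[OF \<Phi>(3,4)] by blast+
    next
      fix u v assume "u \<in> states D \<inter> B" "v \<in> states D - B"
      then have "\<exists>\<Phi>\<in>safe (aps D). sat D u \<Phi> \<and> \<not> sat D v \<Phi>"
        using B(2) by (intro Suc.IH) auto
      then obtain \<Phi> where "\<Phi> \<in> safe (aps D)" "sat D u \<Phi>" "\<not> sat D v \<Phi>"
        by blast
      then show "\<exists>A\<in>?\<S>. u \<in> A \<and> v \<notin> A"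
        by (intro bexI[of _ "{u. sat D u \<Phi>}"]) auto
    qed
    then obtain \<Phi> where \<Phi>: "\<Phi> \<in> safe (aps D)"
      "measure_pmf.prob (trans D s) {u. sat D u \<Phi>} < measure_pmf.prob (trans D t) {u. sat D u \<Phi>}"
      by blast
    \<comment> \<open>The threshold is the exact value at \<open>t\<close>: it is attained there and
      missed at \<open>s\<close>.\<close>
    let ?q = "measure_pmf.prob (trans D t) {u. sat D u \<Phi>}"
    have "Prob Ge ?q (Next \<Phi>) \<in> safe (aps D)"
      using \<Phi>(1) by (intro safe.intros(2)) auto
    moreover have "sat D t (Prob Ge ?q (Next \<Phi>))" "\<not> sat D s (Prob Ge ?q (Next \<Phi>))"
      unfolding sat_Ge_Next using \<Phi>(2) by simp_all
    ultimately show ?thesis by blast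
  next
    case False
    then show ?thesis
      by (rule safe_separates_labels[OF D Suc.prems(1,2)])
  qed
qed

lemma safe_le_eq_bisim:
  assumes "markov_chain D"
  shows "safe_le D = {(s, t) \<in> states D \<times> states D. bisim D s t}"
proof
  show "safe_le D \<subseteq> {(s, t) \<in> states D \<times> states D. bisim D s t}"
    unfolding safe_le_def bisim_def using safe_separates[OF assms] by blast
  show "{(s, t) \<in> states D \<times> states D. bisim D s t} \<subseteq> safe_le D"
    unfolding safe_le_def using bisim_sat[of D] by blast
qed

section \<open>Liveness formulas\<close>

lemma sat_GeI_AE:
  assumes "AE \<pi> in path_measure (trans D) s. sat_path D \<pi> \<phi>" and "q \<le> 1"
  shows "sat D s (Prob Ge q \<phi>)"
proof -
  interpret prob_space "path_measure (trans D) s"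
    by (rule prob_space_path_measure)
  have "prob {\<pi>. sat_path D \<pi> \<phi>} = 1"
    using assms(1) by (subst prob_eq_1[OF sets_sat_path]) simp
  with assms(2) show ?thesis
    by simp
qed

lemma AE_path_states:
  assumes "markov_chain D" and "s \<in> states D"
  shows "AE \<pi> in path_measure (trans D) s. \<forall>i. \<pi> i \<in> states D"
  using assms by (intro AE_path_closed) (auto simp: markov_chain_def)

text \<open>Paths range over the whole type, where \<open>\<Psi>\<close> may hold outside
  \<open>states D\<close>; almost every path avoids those points, so the until event is
  null.\<close>

lemma not_sat_Ge_Until:
  assumes "markov_chain D" and "s \<in> states D" and "\<And>u. u \<in> states D \<Longrightarrow> \<not> sat D u \<Psi>" and "0 < q"
  shows "\<not> sat D s (Prob Ge q (Until \<Phi> \<Psi>))"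
proof -
  interpret prob_space "path_measure (trans D) s"
    by (rule prob_space_path_measure)
  have "AE \<pi> in path_measure (trans D) s. \<not> sat_path D \<pi> (Until \<Phi> \<Psi>)"
    using AE_path_states[OF assms(1,2)] by eventually_elim (simp add: assms(3))
  then have "prob {\<pi>. sat_path D \<pi> (Until \<Phi> \<Psi>)} = 0"
    by (subst prob_eq_0[OF sets_sat_path]) simp
  with assms(4) show ?thesis
    by simp
qed

text \<open>A single model discharges the satisfiability side conditions of the liveness
  clauses.\<close>

lemma not_mc_unsatI:
  fixes M :: "(nat, 'a) mc"
  assumes "markov_chain M" and "aps M = A" and "sat M (init M) \<Phi>"
  shows "\<not> mc_unsat A \<Phi>"
  using assms unfolding mc_unsat_def mc_equiv_def by (metis sat.simps(2,3))

lemma pctl_pnf: "pctl A (pnf b \<Phi>) \<longleftrightarrow> pctl A \<Phi>"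
  and pctl_path_pnf: "pctl_path A (pnf_path \<phi>) \<longleftrightarrow> pctl_path A \<phi>"
  by (induction \<Phi> and \<phi> arbitrary: b) auto

lemma literal_imp_pctl: "\<Phi> \<in> literal A \<Longrightarrow> pctl A \<Phi>"
  by (induction rule: literal.induct) auto

lemma safe_imp_pctl: "\<Phi> \<in> safe A \<Longrightarrow> pctl A \<Phi>"
  by (induction rule: safe.induct) (auto simp: literal_imp_pctl pctl_pnf)

section \<open>A satisfiable liveness formula that fails throughout a given chain\<close>

definition next_prob :: "'a \<Rightarrow> real \<Rightarrow> 'a sform" where
  "next_prob a q = And (Prob Ge q (Next (Atom a))) (Prob Le q (Next (Atom a)))"

lemma sat_next_prob: "sat D s (next_prob a q) \<longleftrightarrow> measure_pmf.prob (trans D s) {u. a \<in> label D u} = q"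
  unfolding next_prob_def sat.simps(2) sat_Ge_Next sat_Le_Next by auto

text \<open>One biased toss leads from the initial state to an absorbing state, labelled with
  \<open>a\<close> or unlabelled. This is a model of \<open>next_prob a q\<close>.\<close>

definition coin_mc :: "'a set \<Rightarrow> 'a \<Rightarrow> real \<Rightarrow> (nat, 'a) mc" where
  "coin_mc A a q = \<lparr>states = {0, 1, 2}, aps = A,
     trans = (\<lambda>s. if s = 0 then map_pmf (\<lambda>b. if b then 1 else 2) (bernoulli_pmf q) else return_pmf s),
     label = (\<lambda>s. if s = 1 then {a} else {}), init = 0\<rparr>"

lemma markov_chain_coin_mc: "finite A \<Longrightarrow> a \<in> A \<Longrightarrow> markov_chain (coin_mc A a q)"
  by (auto simp: markov_chain_def coin_mc_def)

lemma sat_coin_mc: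
  assumes "0 \<le> q" "q \<le> 1"
  shows "sat (coin_mc A a q) 0 (next_prob a q)"
proof -
  have "(\<lambda>b. if b then 1 else 2 :: nat) -` {u. a \<in> (if u = 1 then {a} else {})} = {True}"
    by (auto split: if_splits)
  then show ?thesis
    unfolding sat_next_prob using assms by (simp add: coin_mc_def measure_pmf_single)
qed

text \<open>
  Countably many states realise only countably many probabilities of reaching \<open>a\<close> in one step. If
  \<open>q\<close> is not among them, "eventually the probability of \<open>a\<close> in the next step is \<open>q\<close>" is a
  satisfiable liveness formula which holds nowhere in the given chain. A disjunction with it turns
  every PCTL formula into a liveness formula with the same meaning in that chain.
\<close>

lemma live_gt_nowhere_sat:
  assumes D: "markov_chain D"
  obtains L where "L \<in> live_gt (aps D)" and "pctl (aps D) L"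
    and "\<And>\<Phi>. \<not> mc_unsat (aps D) (Or L \<Phi>)" and "\<And>s. s \<in> states D \<Longrightarrow> \<not> sat D s L"
proof -
  let ?A = "aps D"
  obtain a where a: "a \<in> ?A"
    using D by (auto simp: markov_chain_def)
  let ?p = "\<lambda>u. measure_pmf.prob (trans D u) {v. a \<in> label D v}"
  have "countable (?p ` states D)"
    using D by (simp add: markov_chain_def)
  moreover have "uncountable {0..1::real}"
    by (simp add: uncountable_closed_interval)
  ultimately have "\<not> {0..1} \<subseteq> ?p ` states D"
    using countable_subset by blast
  then obtain q where q: "q \<in> {0..1}" "q \<notin> ?p ` states D"
    by blast
  let ?L = "Prob Ge 1 (Until (Top a) (next_prob a q))"
  let ?M = "coin_mc ?A a q"
  have M: "markov_chain ?M" "aps ?M = ?A" "init ?M = 0"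
    using D a markov_chain_coin_mc[of ?A a q] by (auto simp: markov_chain_def coin_mc_def)
  have sat_M: "sat ?M (init ?M) ?L"
    unfolding M(3)
  proof (rule sat_GeI_AE)
    show "AE \<pi> in path_measure (trans ?M) 0. sat_path ?M \<pi> (Until (Top a) (next_prob a q))"
      using AE_path_start
    proof eventually_elim
      case (elim \<pi>)
      then have "sat ?M (\<pi> 0) (next_prob a q)"
        using sat_coin_mc q(1) by auto
      then show ?case
        unfolding sat_path.simps by blast
    qed
  qed simp
  have pctl: "pctl ?A (next_prob a q)"
    using a q(1) by (simp add: next_prob_def)
  show ?thesis
  proof
    show "?L \<in> live_gt ?A"
    proof (rule live_gt.intros(7))
      \<comment> \<open>Liveness of the left operand is enough here, so the right one may be any
        PCTL formula. The corresponding clause of \<open>live_lt\<close> demands liveness of the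
        right operand instead.\<close>
      show "Top a \<in> live_gt ?A \<or> next_prob a q \<in> live_gt ?A"
        using live_gt.intros(1)[OF a] ..
      show "\<not> mc_unsat ?A ?L"
        by (rule not_mc_unsatI[OF M(1,2) sat_M])
    qed (use a pctl in simp_all)
    show "pctl ?A ?L"
      using a pctl by simp
    show "\<not> mc_unsat ?A (Or ?L \<Phi>)" for \<Phi>
      by (rule not_mc_unsatI[OF M(1,2)], subst sat_Or, rule disjI1, rule sat_M)
    show "\<not> sat D s ?L" if "s \<in> states D" for s
      using q(2) by (intro not_sat_Ge_Until[OF D that]) (auto simp: sat_next_prob)
  qed
qed

text \<open>Safety is transferred from \<open>t\<close> to \<open>s\<close> and liveness from
  \<open>s\<close> to \<open>t\<close>, so a safety formula enters through its negation, made a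
  liveness formula by the disjunct \<open>L\<close> that is false in all states of
  \<open>D\<close>.\<close>

lemma live2_le_eq_bisim:
  assumes D: "markov_chain D"
  shows "live2_le D = {(s, t) \<in> states D \<times> states D. bisim D s t}"
proof
  obtain L where L: "L \<in> live_gt (aps D)" "pctl (aps D) L"
      "\<And>\<Phi>. \<not> mc_unsat (aps D) (Or L \<Phi>)" "\<And>s. s \<in> states D \<Longrightarrow> \<not> sat D s L"
    using live_gt_nowhere_sat[OF D] by blast
  have "(s, t) \<in> safe_le D" if "(s, t) \<in> live2_le D" for s t
  proof -
    have st: "s \<in> states D" "t \<in> states D" "\<And>\<Phi>. \<Phi> \<in> live_gt (aps D) \<Longrightarrow> sat D s \<Phi> \<Longrightarrow> sat D t \<Phi>"
      using that unfolding live2_le_def by blast+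
    have "sat D s \<Phi>" if "\<Phi> \<in> safe (aps D)" "sat D t \<Phi>" for \<Phi>
    proof (rule ccontr)
      assume "\<not> sat D s \<Phi>"
      then have "sat D s (Or L (Neg \<Phi>))"
        by simp
      moreover have "Or L (Neg \<Phi>) \<in> live_gt (aps D)"
        using L safe_imp_pctl[OF that(1)] by (intro live_gt.intros(4)) auto
      ultimately have "sat D t (Or L (Neg \<Phi>))"
        by (intro st(3))
      with that(2) L(4)[OF st(2)] show False
        by simp
    qed
    then show ?thesis
      using st(1,2) unfolding safe_le_def by blast
  qed
  then show "live2_le D \<subseteq> {(s, t) \<in> states D \<times> states D. bisim D s t}"
    unfolding safe_le_eq_bisim[OF D] by blast
  show "{(s, t) \<in> states D \<times> states D. bisim D s t} \<subseteq> live2_le D"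
    unfolding live2_le_def using bisim_sat[of D] by blast
qed

section \<open>A chain with a coarser liveness preorder\<close>

text \<open>The states may belong to different chains, so that unsatisfiability in every chain can
  be read off from the labels of one.\<close>

lemma sat_literal_cong:
  assumes "\<Phi> \<in> literal A" and "label D s \<inter> A = label D' s' \<inter> A"
  shows "sat D s \<Phi> \<longleftrightarrow> sat D' s' \<Phi>"
  using assms(1)
proof induction
  case (1 a)
  then show ?case using assms(2) by auto
qed simp_all

text \<open>Truncated subtraction makes \<open>1 - s\<close> swap 0 and 1.\<close>

definition flip_mc :: "(nat, nat) mc" where
  "flip_mc = \<lparr>states = {0, 1}, aps = {0}, trans = (\<lambda>s. return_pmf (1 - s)),
     label = (\<lambda>s. if s = 0 then {0} else {}), init = 0\<rparr>"

lemma markov_chain_flip_mc: "markov_chain flip_mc"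
  by (auto simp: markov_chain_def flip_mc_def)

lemma AE_flip_mc_next: "AE \<pi> in path_measure (trans flip_mc) s. \<pi> 1 = 1 - s"
proof -
  interpret prob_space "path_measure (trans flip_mc) s"
    by (rule prob_space_path_measure)
  have "prob {\<pi> \<in> space (path_measure (trans flip_mc) s). \<pi> 1 = 1 - s} = 1"
    using prob_path_Next[of "trans flip_mc" s "{1 - s}"] by (simp add: flip_mc_def)
  then show ?thesis
    by (subst (asm) prob_Collect_eq_1) measurable
qed

text \<open>
  Every label occurs within one step, so eventualities of satisfiable literal formulas hold, and
  the remaining clauses preserve validity in the chain.
\<close>

lemma flip_mc_sat_eventually_literal:
  assumes \<Phi>: "\<Phi> \<in> literal {0}" and q: "q \<in> {0..1}" and s: "s \<in> states flip_mc"
    and sat: "\<not> mc_unsat {0} (Prob Ge q (Until (Top 0) \<Phi>))"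
  shows "sat flip_mc s (Prob Ge q (Until (Top 0) \<Phi>))"
proof (cases "sat flip_mc 0 \<Phi> \<or> sat flip_mc 1 \<Phi>")
  case True
  show ?thesis
  proof (rule sat_GeI_AE)
    show "AE \<pi> in path_measure (trans flip_mc) s. sat_path flip_mc \<pi> (Until (Top 0) \<Phi>)"
      using AE_path_start AE_flip_mc_next
    proof eventually_elim
      case (elim \<pi>)
      have "sat flip_mc (\<pi> 0) \<Phi> \<or> sat flip_mc (\<pi> 1) \<Phi>"
        unfolding elim using True s by (auto simp: flip_mc_def)
      then show ?case
        unfolding sat_path.simps by auto
    qed
  qed (use q in simp)
next
  case False
  \<comment> \<open>The two states realise all labels over a single proposition. A literal formula
    false in both is therefore false in every state of every chain over it, and a positive bound
    would make the eventuality unsatisfiable.\<close>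
  have "q = 0"
  proof (rule ccontr)
    assume "q \<noteq> 0"
    with q have "0 < q" by simp
    have "\<not> sat M (init M) (Prob Ge q (Until (Top 0) \<Phi>))"
      if M: "markov_chain M" "aps M = {0}" for M :: "(nat, nat) mc"
    proof (rule not_sat_Ge_Until[OF M(1) _ _ \<open>0 < q\<close>])
      show "init M \<in> states M"
        using M(1) by (simp add: markov_chain_def)
      fix u assume "u \<in> states M"
      then have "label M u \<subseteq> {0}"
        using M by (auto simp: markov_chain_def)
      then have "label M u \<inter> {0} = label flip_mc 0 \<inter> {0} \<or> label M u \<inter> {0} = label flip_mc 1 \<inter> {0}"
        by (auto simp: flip_mc_def)
      then have "(sat M u \<Phi> \<longleftrightarrow> sat flip_mc 0 \<Phi>) \<or> (sat M u \<Phi> \<longleftrightarrow> sat flip_mc 1 \<Phi>)"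
        using sat_literal_cong[OF \<Phi>, of M u flip_mc 0] sat_literal_cong[OF \<Phi>, of M u flip_mc 1]
        by argo
      with False show "\<not> sat M u \<Phi>"
        by argo
    qed
    then have "mc_equiv {0} (Prob Ge q (Until (Top 0) \<Phi>)) (Bot 0)"
      unfolding mc_equiv_def by auto
    with sat show False
      by (simp add: mc_unsat_def)
  qed
  then show ?thesis
    by simp
qed

lemma flip_mc_live_lt:
  assumes "\<Phi> \<in> live_lt {0}"
  shows "\<forall>s\<in>states flip_mc. sat flip_mc s \<Phi>"
  using assms
proof induction
  case (1 a)
  then show ?case by simp
next
  case (2 \<Phi> a q)
  then show ?case
    using flip_mc_sat_eventually_literal by blast
next
  case (3 \<Phi> \<Psi>)
  then show ?case by simp
next
  case (4 \<Phi> \<Psi>)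
  then show ?case by auto
next
  case (5 \<Phi> \<Psi> q)
  show ?case
  proof
    fix s assume s: "s \<in> states flip_mc"
    show "sat flip_mc s (Prob Ge q (WUntil \<Phi> \<Psi>))"
    proof (rule sat_GeI_AE)
      show "AE \<pi> in path_measure (trans flip_mc) s. sat_path flip_mc \<pi> (WUntil \<Phi> \<Psi>)"
        using AE_path_states[OF markov_chain_flip_mc s]
        \<comment> \<open>If the left operand is valid, it holds along the whole path; if the right
          one is, weak until is fulfilled at time 0.\<close>
        by eventually_elim (unfold sat_path.simps, use 5 in blast)
    qed (use 5 in simp)
  qed
next
  case (6 \<Phi> q)
  show ?case
  proof
    fix s assume s: "s \<in> states flip_mc"
    show "sat flip_mc s (Prob Ge q (Next \<Phi>))"
    proof (rule sat_GeI_AE)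
      show "AE \<pi> in path_measure (trans flip_mc) s. sat_path flip_mc \<pi> (Next \<Phi>)"
        using AE_path_states[OF markov_chain_flip_mc s]
        by eventually_elim (unfold sat_path.simps, use 6 in blast)
    qed (use 6 in simp)
  qed
next
  case (7 \<Psi> \<Phi> q)
  show ?case
  proof
    fix s assume s: "s \<in> states flip_mc"
    show "sat flip_mc s (Prob Ge q (Until \<Phi> \<Psi>))"
    proof (rule sat_GeI_AE)
      show "AE \<pi> in path_measure (trans flip_mc) s. sat_path flip_mc \<pi> (Until \<Phi> \<Psi>)"
        using AE_path_states[OF markov_chain_flip_mc s]
        \<comment> \<open>The right operand holds at time 0, where nothing is demanded of
          \<open>\<Phi>\<close>.\<close>
        by eventually_elim (unfold sat_path.simps, use 7 in blast)
    qed (use 7 in simp)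
  qed
qed

lemma live1_le_flip_mc: "live1_le flip_mc = states flip_mc \<times> states flip_mc"
proof -
  have "aps flip_mc = {0}"
    by (simp add: flip_mc_def)
  then show ?thesis
    unfolding live1_le_def using flip_mc_live_lt by auto
qed

theorem theorem8:
  shows "(\<forall>D :: ('s, 'a) mc. markov_chain D \<longrightarrow>
            sim_le D = safe_le D \<and> safe_le D = live2_le D \<and> live2_le D \<subseteq> live1_le D) \<and>
         (\<exists>D :: (nat, nat) mc. markov_chain D \<and> live2_le D \<subset> live1_le D)"
proof (intro conjI allI impI exI[of _ flip_mc])
  fix D :: "('s, 'a) mc" assume D: "markov_chain D"
  show "sim_le D = safe_le D"
    unfolding sim_le_eq_bisim[OF D] safe_le_eq_bisim[OF D] ..
  show "safe_le D = live2_le D"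
    unfolding safe_le_eq_bisim[OF D] live2_le_eq_bisim[OF D] ..
  show "live2_le D \<subseteq> live1_le D"
    unfolding live2_le_eq_bisim[OF D] live1_le_def using bisim_sat[of D] by blast
next
  show "markov_chain flip_mc"
    by (rule markov_chain_flip_mc)
  have "\<not> bisim flip_mc 0 1"
    using bisim_imp_label[of flip_mc 0 1] by (auto simp: flip_mc_def)
  then have "(0, 1) \<notin> live2_le flip_mc"
    unfolding live2_le_eq_bisim[OF markov_chain_flip_mc] by simp
  moreover have "(0, 1) \<in> live1_le flip_mc"
    unfolding live1_le_flip_mc by (simp add: flip_mc_def)
  ultimately show "live2_le flip_mc \<subset> live1_le flip_mc"
    unfolding live1_le_flip_mc by (auto simp: live2_le_def)
qed

end
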